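(* Let $\Omega\subset\mathbb R^2$ be a bounded and simply connected domain with $C^1$-regular boundary, and let $F=F(x,y,z,p,q)\in C^2(\mathbb R^5,\mathbb R)$ and $R=R(x,y,z,p,q)\in C^0(\mathbb R^5,\mathbb R)$. Let $\zeta\in C^2(\Omega,\mathbb R)\cap C^1(\overline\Omega,\mathbb R)$ solve the elliptic Dirichlet boundary value problem $$\frac{d}{dx}F_p(x,y,\zeta,\zeta_x,\zeta_y)+\frac{d}{dy}F_q(x,y,\zeta,\zeta_x,\zeta_y)=R(x,y,\zeta,\zeta_x,\zeta_y)\ \text{in}\ \Omega,\qquad \zeta=\varphi\ \text{on}\ \partial\Omega,$$ where $\varphi\in C^1(\mathbb R^2,\mathbb R)$. Assume that: (A1) for all $(x,y,z,p,q)\in\mathbb R^5$, $F_p(x,y,z,p,q)^2+F_q(x,y,z,p,q)^2\le k_0^2$ with a real constant $k_0\in[0,+\infty)$; (A2) with a real constant $m_1\in(0,+\infty)$, $$m_1|\xi|^2\le(\xi_1,\xi_2)\begin{pmatrix} F_{pp}(x,y,z,\tilde p,\tilde q) & F_{pq}(x,y,z,\tilde p,\tilde q) \\ F_{qp}(x,y,z,\tilde p,\tilde q) & F_{qq}(x,y,z,\tilde p,\tilde q) \end{pmatrix}\begin{pmatrix} \xi_1 \\ \xi_2 \end{pmatrix}$$ for all $(x,y,z)\in\mathbb R^3$, all $\xi=(\xi_1,\xi_2)\in\mathbb R^2$ and all $\tilde p,\tilde q\in\mathbb R$ with $\tilde p^2+\tilde q^2\le1$; (A3) $F_p(x,y,z,0,0)=0$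 and $F_q(x,y,z,0,0)=0$ for all $(x,y,z)\in\mathbb R^3$. Then $$\mathcal A[\zeta]\le\left(1+\frac{\|\zeta\|_{0,\Omega}\,\|R\|_{0,\Omega}}{m_1}\right)\mathcal A[\Omega]+\frac{\|\zeta\|_{0,\partial\Omega}\,k_0}{m_1}\,\mathcal L[\partial\Omega].$$
   Context: $\mathcal A[\zeta]=\iint_\Omega\sqrt{1+\zeta_x^2+\zeta_y^2}\,dx\,dy$ is the area of the graph of $\zeta$, $\mathcal A[\Omega]$ is the area of $\Omega$, and $\mathcal L[\partial\Omega]$ is the length of $\partial\Omega$. $\|\cdot\|_{0,\Omega}$ and $\|\cdot\|_{0,\partial\Omega}$ are the supremum norms over $\Omega$ and $\partial\Omega$, and $\|R\|_{0,\Omega}=\sup_{(x,y)\in\Omega}|R(x,y,\zeta,\zeta_x,\zeta_y)|$. Subscripts of $F$ denote partial derivatives, and $\frac{d}{dx},\frac{d}{dy}$ denote total derivatives of the composed functions. "Elliptic" means that the matrix $\begin{pmatrix} F_{pp} & F_{pq} \\ F_{qp} & F_{qq} \end{pmatrix}(x,y,z,p,q)$ is positive definite for all $(x,y,z,p,q)\in\mathbb R^5$. *)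

theory Defs
  imports "HOL-Analysis.Analysis"
begin

(* The classes C^1, C^2 in the Frechet sense; both are only meant for open S. *)

definition C1_on :: "('a::real_normed_vector \<Rightarrow> 'b::real_normed_vector) \<Rightarrow> 'a set \<Rightarrow> bool" where
  "C1_on f S \<longleftrightarrow>
     (\<exists>f'. (\<forall>x\<in>S. (f has_derivative blinfun_apply (f' x)) (at x)) \<and> continuous_on S f')"

definition C2_on :: "('a::real_normed_vector \<Rightarrow> 'b::real_normed_vector) \<Rightarrow> 'a set \<Rightarrow> bool" where
  "C2_on f S \<longleftrightarrow>
     (\<exists>f'. (\<forall>x\<in>S. (f has_derivative blinfun_apply (f' x)) (at x)) \<and> C1_on f' S)"

(* C^1 up to the boundary of the open set S: f and its derivative, which is only taken inside S,
   extend continuously to the closure. *)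

definition C1_on_closure :: "('a::real_normed_vector \<Rightarrow> 'b::real_normed_vector) \<Rightarrow> 'a set \<Rightarrow> bool" where
  "C1_on_closure f S \<longleftrightarrow> continuous_on (closure S) f \<and>
     (\<exists>f'. (\<forall>x\<in>S. (f has_derivative blinfun_apply (f' x)) (at x)) \<and> continuous_on (closure S) f')"

(* Near each of its boundary points, the set is, in rotated or reflected Cartesian coordinates
   (w \<bullet> u, w \<bullet> v), the part of the plane above the graph of a C^1 function. *)

definition C1_regular_boundary :: "(real \<times> real) set \<Rightarrow> bool" where
  "C1_regular_boundary \<Omega> \<longleftrightarrow>
     (\<forall>a\<in>frontier \<Omega>. \<exists>u v r g.
        norm u = 1 \<and> norm v = 1 \<and> u \<bullet> v = 0 \<and> r > 0 \<and>
        (g :: real \<Rightarrow> real) C1_differentiable_on UNIV \<and>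
        \<Omega> \<inter> ball a r = {w \<in> ball a r. g (w \<bullet> u) < w \<bullet> v})"

(* The length of a set is its one-dimensional Hausdorff measure; in dimension one the usual
   normalizing constant is 1. Coverings are required to be bounded because diameter is
   unspecified on unbounded sets. *)

definition hausdorff1_approx :: "real \<Rightarrow> 'a::metric_space set \<Rightarrow> ennreal" where
  "hausdorff1_approx \<delta> S =
     Inf {(\<Sum>i. ennreal (diameter (C i))) | C :: nat \<Rightarrow> 'a set.
            S \<subseteq> (\<Union>i. C i) \<and> (\<forall>i. bounded (C i) \<and> diameter (C i) \<le> \<delta>)}"

definition hausdorff1 :: "'a::metric_space set \<Rightarrow> ennreal" where
  "hausdorff1 S = (SUP \<delta>\<in>{0<..}. hausdorff1_approx \<delta> S)"

definition curve_length :: "'a::metric_space set \<Rightarrow> real" where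
  "curve_length S = enn2real (hausdorff1 S)"

definition sup_norm_on :: "'a set \<Rightarrow> ('a \<Rightarrow> real) \<Rightarrow> real" where
  "sup_norm_on S f = (SUP w\<in>S. \<bar>f w\<bar>)"

definition D_x :: "(real \<times> real \<Rightarrow> real) \<Rightarrow> real \<times> real \<Rightarrow> real" where
  "D_x f = (\<lambda>(x, y). deriv (\<lambda>t. f (t, y)) x)"

definition D_y :: "(real \<times> real \<Rightarrow> real) \<Rightarrow> real \<times> real \<Rightarrow> real" where
  "D_y f = (\<lambda>(x, y). deriv (\<lambda>t. f (x, t)) y)"

(* Points of R^5 are written (x, y, z, p, q). *)

type_synonym real5 = "real \<times> real \<times> real \<times> real \<times> real"

definition D_p :: "(real5 \<Rightarrow> real) \<Rightarrow> real5 \<Rightarrow> real" where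
  "D_p F = (\<lambda>(x, y, z, p, q). deriv (\<lambda>t. F (x, y, z, t, q)) p)"

definition D_q :: "(real5 \<Rightarrow> real) \<Rightarrow> real5 \<Rightarrow> real" where
  "D_q F = (\<lambda>(x, y, z, p, q). deriv (\<lambda>t. F (x, y, z, p, t)) q)"

definition pq_matrix :: "(real5 \<Rightarrow> real) \<Rightarrow> real5 \<Rightarrow> real^2^2" where
  "pq_matrix F w = vector [vector [D_p (D_p F) w, D_q (D_p F) w],
                           vector [D_p (D_q F) w, D_q (D_q F) w]]"

definition pos_definite :: "real^'n^'n \<Rightarrow> bool" where
  "pos_definite A \<longleftrightarrow> (\<forall>\<xi>. \<xi> \<noteq> 0 \<longrightarrow> \<xi> \<bullet> (A *v \<xi>) > 0)"

definition elliptic :: "(real5 \<Rightarrow> real) \<Rightarrow> bool" where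
  "elliptic F \<longleftrightarrow> (\<forall>w. pos_definite (pq_matrix F w))"

definition jet :: "(real \<times> real \<Rightarrow> real) \<Rightarrow> real \<times> real \<Rightarrow> real5" where
  "jet \<zeta> = (\<lambda>(x, y). (x, y, \<zeta> (x, y), D_x \<zeta> (x, y), D_y \<zeta> (x, y)))"

definition graph_area :: "(real \<times> real) set \<Rightarrow> (real \<times> real \<Rightarrow> real) \<Rightarrow> real" where
  "graph_area \<Omega> \<zeta> = (LINT w:\<Omega>|lborel. sqrt (1 + (D_x \<zeta> w)\<^sup>2 + (D_y \<zeta> w)\<^sup>2))"

end

theory Submission
  imports Defs
begin

text \<open>
The field \<open>W = \<zeta> (F\<^sub>p, F\<^sub>q)\<close>, taken along the jet of the solution, has divergence
\<open>\<zeta> R + \<zeta>\<^sub>x F\<^sub>p + \<zeta>\<^sub>y F\<^sub>q\<close> by the differential equation. Ellipticity bounds the last two terms from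
below by \<open>m\<^sub>1 (sqrt (1 + \<zeta>\<^sub>x\<^sup>2 + \<zeta>\<^sub>y\<^sup>2) - 1)\<close> (lemma \<open>elliptic_lower_bound\<close>). Integration shows that
\<open>m\<^sub>1\<close> times the difference of the areas of the graph and of the domain is at most the integral of
the divergence of \<open>W\<close> minus the integral of \<open>\<zeta> R\<close>. The latter is bounded by the supremum norms times
the area of the domain, so it remains to bound the former by \<open>sup |W|\<close> over the boundary times the
length of the boundary, where \<open>|W| \<le> |\<zeta>| k\<^sub>0\<close>. This is lemma \<open>divergence_le_boundary\<close>.

Two difficulties shape the proof of that lemma. The second derivatives of the solution need not be
bounded near the boundary, so the divergence of \<open>W\<close> is integrable but its two terms may not be.
Therefore each boundary patch is flattened by area-preserving graph coordinates, and the integral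
over the half-plane \<open>s > 0\<close> is approached from the half-planes \<open>s \<ge> \<sigma>\<close>
(\<open>half_plane_divergence\<close>, \<open>graph_patch_divergence\<close>). Moreover, the length is a Hausdorff measure,
that is, it is given by coverings. A covering set of diameter \<open>d\<close> meets a \<open>C\<^sup>1\<close> graph in a set that
lies on an arc of length little more than \<open>d\<close>, so the boundary integral of each patch is at most a
weighted sum of the diameters (\<open>graph_cover_estimate\<close>); the weights come from a partition of unity
and add up to one over all patches.
\<close>

section \<open>Area-preserving graph coordinates\<close>

lemma distr_lborel_shear:
  fixes h :: "real \<Rightarrow> real"
  assumes [measurable]: "h \<in> borel_measurable borel"
  shows "distr lborel borel (\<lambda>(x, s). (x, s + h x)) = lborel"
proof (rule measure_eqI)
  fix A :: "(real \<times> real) set" assume "A \<in> sets (distr lborel borel (\<lambda>(x, s). (x, s + h x)))"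
  then have [measurable]: "A \<in> sets borel" by simp
  have m[measurable]: "(\<lambda>(x, s). (x, s + h x)) \<in> borel_measurable (borel :: (real \<times> real) measure)"
    by (simp add: borel_prod[symmetric])
  have [measurable]: "A \<in> sets (borel \<Otimes>\<^sub>M borel)" using \<open>A \<in> sets borel\<close> by (simp only: borel_prod)
  have "emeasure (distr lborel borel (\<lambda>(x, s). (x, s + h x))) A
      = (\<integral>\<^sup>+w. indicator A w \<partial>distr lborel borel (\<lambda>(x, s). (x, s + h x)))"
    by simp
  also have "\<dots> = (\<integral>\<^sup>+w. indicator A (case w of (x, s) \<Rightarrow> (x, s + h x)) \<partial>lborel)"
    by (subst nn_integral_distr) (auto simp: case_prod_beta)
  also have "\<dots> = (\<integral>\<^sup>+w. indicator A (case w of (x, s) \<Rightarrow> (x, s + h x)) \<partial>(lborel \<Otimes>\<^sub>M lborel))"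
    by (simp add: lborel_prod)
  also have "\<dots> = (\<integral>\<^sup>+x. (\<integral>\<^sup>+s. indicator A (x, s + h x) \<partial>lborel) \<partial>lborel)"
    by (subst lborel.nn_integral_fst[symmetric]) auto
  also have "\<dots> = (\<integral>\<^sup>+x. (\<integral>\<^sup>+s. indicator A (x, s) \<partial>lborel) \<partial>lborel)"
  proof (rule nn_integral_cong)
    fix x :: real
    have "(\<integral>\<^sup>+s. indicator A (x, s) \<partial>lborel) = (\<integral>\<^sup>+s. indicator A (x, s) \<partial>distr lborel borel ((+) (h x)))"
      by (simp add: lborel_distr_plus)
    also have "\<dots> = (\<integral>\<^sup>+s. indicator A (x, s + h x) \<partial>lborel)"
      by (subst nn_integral_distr) (auto simp: add.commute)
    finally show "(\<integral>\<^sup>+s. indicator A (x, s + h x) \<partial>lborel) = (\<integral>\<^sup>+s. indicator A (x, s) \<partial>lborel)" by simp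
  qed
  also have "\<dots> = (\<integral>\<^sup>+w. indicator A w \<partial>(lborel \<Otimes>\<^sub>M lborel))"
    by (subst lborel.nn_integral_fst[symmetric]) auto
  also have "\<dots> = emeasure lborel A" by (simp add: lborel_prod)
  finally show "emeasure (distr lborel borel (\<lambda>(x, s). (x, s + h x))) A = emeasure lborel A" .
qed simp

lemma distr_lborel_swap: "distr lborel borel (\<lambda>(x, y). (y, x)) = (lborel :: (real \<times> real) measure)"
proof -
  have "(lborel :: (real \<times> real) measure) = lborel \<Otimes>\<^sub>M lborel" by (simp add: lborel_prod)
  also have "\<dots> = distr (lborel \<Otimes>\<^sub>M lborel) (lborel \<Otimes>\<^sub>M lborel) (\<lambda>(x, y). (y, x))"
    by (rule lborel_pair.distr_pair_swap)
  also have "\<dots> = distr lborel borel (\<lambda>(x, y). (y, x))"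
    unfolding lborel_prod by (rule distr_cong) auto
  finally show ?thesis by simp
qed

lemma distr_lborel_comp:
  fixes f g :: "'a::euclidean_space \<Rightarrow> 'a"
  assumes "f \<in> borel_measurable borel" "g \<in> borel_measurable borel"
    and "distr lborel borel f = lborel" "distr lborel borel g = lborel"
  shows "distr lborel borel (f \<circ> g) = lborel"
proof -
  have "distr (distr lborel borel g) borel f = distr lborel borel (f \<circ> g)"
    by (rule distr_distr) (use assms in auto)
  with assms show ?thesis by simp
qed

text \<open>
A matrix with nonzero upper left entry is a lower shear times a diagonal matrix times an upper
shear; each factor preserves area when the determinant has modulus one.
\<close>
lemma distr_lborel_linear_aux:
  fixes a b c d :: real
  assumes "a \<noteq> 0" "\<bar>a * d - b * c\<bar> = 1"
  shows "distr lborel borel (\<lambda>(x, y). (a * x + b * y, c * x + d * y)) = lborel"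
proof -
  define e where "e = (a * d - b * c) / a"
  define k where "k = (\<lambda>i::real \<times> real. if i = (1, 0) then a else e)"
  define T where "T = (\<lambda>w::real \<times> real. 0 + (\<Sum>j\<in>Basis. (k j * (w \<bullet> j)) *\<^sub>R j))"
  have e: "\<bar>a\<bar> * \<bar>e\<bar> = 1" using assms by (simp add: e_def abs_divide)
  then have knz: "\<And>j. j \<in> Basis \<Longrightarrow> k j \<noteq> 0" using assms(1) by (auto simp: k_def)
  have pr: "(\<Prod>j\<in>Basis. \<bar>k j\<bar>) = 1"
    using e by (simp add: Basis_prod_def k_def prod.union_disjoint mult.commute)
  have T: "T = (\<lambda>(x, y). (a * x, e * y))"
    by (auto simp: T_def Basis_prod_def k_def fun_eq_iff sum.union_disjoint)
  have "lborel = density (distr lborel borel T) (\<lambda>_. ennreal (\<Prod>j\<in>Basis. \<bar>k j\<bar>))"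
    unfolding T_def by (rule lborel_affine_euclidean[OF knz])
  then have dT: "distr lborel borel (\<lambda>(x, y). (a * x, e * y)) = (lborel :: (real \<times> real) measure)"
    by (simp add: pr density_1 T)
  let ?S1 = "\<lambda>(x::real, s::real). (x, s + c / a * x)"
  let ?S2 = "\<lambda>(x::real, s::real). (x, s + b / a * x)"
  let ?w = "\<lambda>(x::real, y::real). (y, x)"
  have m: "\<And>t. (\<lambda>(x::real, s::real). (x, s + t * x)) \<in> borel_measurable borel"
     "?w \<in> borel_measurable borel" "(\<lambda>(x, y). (a * x, e * y)) \<in> borel_measurable borel"
    by (auto simp: case_prod_beta intro!: borel_measurable_continuous_onI continuous_intros)
  have s: "\<And>t. distr lborel borel (\<lambda>(x::real, s::real). (x, s + t * x)) = lborel"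
    by (rule distr_lborel_shear) simp
  have "distr lborel borel (?S1 \<circ> ((\<lambda>(x, y). (a * x, e * y)) \<circ> (?w \<circ> (?S2 \<circ> ?w)))) = lborel"
    by (intro distr_lborel_comp m s dT distr_lborel_swap measurable_comp[of _ borel borel])
  moreover have "?S1 \<circ> ((\<lambda>(x, y). (a * x, e * y)) \<circ> (?w \<circ> (?S2 \<circ> ?w))) = (\<lambda>(x, y). (a * x + b * y, c * x + d * y))"
    using assms(1) by (auto simp: fun_eq_iff e_def field_simps)
  ultimately show ?thesis by simp
qed

lemma distr_lborel_linear:
  fixes a b c d :: real
  assumes "\<bar>a * d - b * c\<bar> = 1"
  shows "distr lborel borel (\<lambda>(x, y). (a * x + b * y, c * x + d * y)) = lborel"
proof (cases "a = 0")
  case True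
  let ?w = "\<lambda>(x::real, y::real). (y, x)"
  let ?L = "\<lambda>(x, y). (b * x + a * y, d * x + c * y)"
  have "distr lborel borel ?L = lborel"
    using assms True by (intro distr_lborel_linear_aux) auto
  then have "distr lborel borel (?L \<circ> ?w) = lborel"
    by (intro distr_lborel_comp distr_lborel_swap)
       (auto simp: case_prod_beta intro!: borel_measurable_continuous_onI continuous_intros)
  moreover have "?L \<circ> ?w = (\<lambda>(x, y). (a * x + b * y, c * x + d * y))"
    by (auto simp: fun_eq_iff)
  ultimately show ?thesis by simp
qed (rule distr_lborel_linear_aux[OF _ assms])

text \<open>
In the plane the second vector of an orthonormal pair is the first one turned by a right angle, up
to the sign \<open>e\<close>, which is negative for reflected coordinates.
\<close>
lemma orthonormal_pair_coords:
  fixes u v :: "real \<times> real"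
  assumes "norm u = 1" "norm v = 1" "u \<bullet> v = 0"
  obtains c s e where "c\<^sup>2 + s\<^sup>2 = 1" "e = 1 \<or> e = -1" "u = (c, s)" "v = (- e * s, e * c)"
proof -
  obtain c s where u: "u = (c, s)" by (cases u)
  obtain p q where v: "v = (p, q)" by (cases v)
  have 1: "c\<^sup>2 + s\<^sup>2 = 1" "p\<^sup>2 + q\<^sup>2 = 1" "c * p + s * q = 0"
    using assms by (simp_all add: u v norm_Pair)
  define e where "e = c * q - s * p"
  have "e\<^sup>2 + (c * p + s * q)\<^sup>2 = (c\<^sup>2 + s\<^sup>2) * (p\<^sup>2 + q\<^sup>2)"
    by (simp add: e_def) algebra
  then have "e\<^sup>2 = 1" using 1 by simp
  then have e: "e = 1 \<or> e = -1" by (simp add: power2_eq_1_iff)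
  have "q = e * c" "p = - e * s" unfolding e_def using 1 by algebra+
  with 1 e u v show thesis by (intro that[of c s e]) auto
qed

text \<open>
These are the coordinates in which a piece of the domain above the graph of \<open>g\<close> becomes a piece of
the half-plane \<open>s > 0\<close>. They preserve area, being a shear followed by an isometry.
\<close>
lemma distr_lborel_graph_coords:
  fixes u v :: "real \<times> real" and g :: "real \<Rightarrow> real"
  assumes uv: "norm u = 1" "norm v = 1" "u \<bullet> v = 0" and g: "continuous_on UNIV g"
  shows "distr lborel borel (\<lambda>(x, s). x *\<^sub>R u + (s + g x) *\<^sub>R v) = lborel"
proof -
  obtain c s e where 1: "c\<^sup>2 + s\<^sup>2 = 1" "e = 1 \<or> e = -1" "u = (c, s)" "v = (- e * s, e * c)"
    using orthonormal_pair_coords[OF uv] .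
  let ?L = "\<lambda>(x, y). (c * x + (- e * s) * y, s * x + (e * c) * y)"
  have "c * (e * c) - (- e * s) * s = e * (c\<^sup>2 + s\<^sup>2)" by (simp add: power2_eq_square algebra_simps)
  with 1 have "\<bar>c * (e * c) - (- e * s) * s\<bar> = 1" by auto
  then have L: "distr lborel borel ?L = lborel" by (rule distr_lborel_linear)
  have gm: "g \<in> borel_measurable borel" using g by (rule borel_measurable_continuous_onI)
  have "distr lborel borel (?L \<circ> (\<lambda>(x, s). (x, s + g x))) = lborel"
    using gm by (intro distr_lborel_comp L distr_lborel_shear gm)
       (auto simp: case_prod_beta borel_prod[symmetric])
  moreover have "?L \<circ> (\<lambda>(x, s). (x, s + g x)) = (\<lambda>(x, s). x *\<^sub>R u + (s + g x) *\<^sub>R v)"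
    by (auto simp: fun_eq_iff 1)
  ultimately show ?thesis by simp
qed

section \<open>The divergence theorem in a half-plane\<close>

text \<open>
Only the sum \<open>P1 + Q2\<close> is bounded near the line \<open>s = 0\<close>; the two terms separately may fail to be
integrable there. Hence the integral is first taken over the boxes \<open>s \<ge> \<sigma> > 0\<close>, where the terms can be
separated and integrated one variable at a time, and then \<open>\<sigma>\<close> tends to zero: dominated convergence
applies to the sum, and the boundary term converges because \<open>Q\<close> is continuous up to \<open>s = 0\<close>.
\<close>
lemma half_plane_divergence:
  fixes P Q P1 Q2 :: "real \<times> real \<Rightarrow> real"
  assumes B: "0 < B"
    and dP: "\<And>x s. 0 < s \<Longrightarrow> ((\<lambda>x. P (x, s)) has_real_derivative P1 (x, s)) (at x)"
    and dQ: "\<And>x s. 0 < s \<Longrightarrow> ((\<lambda>s. Q (x, s)) has_real_derivative Q2 (x, s)) (at s)"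
    and cP1: "continuous_on (UNIV \<times> {0<..}) P1" and cQ2: "continuous_on (UNIV \<times> {0<..}) Q2"
    and cQ: "continuous_on (UNIV \<times> {0..}) Q"
    and supp: "\<And>x s. 0 < s \<Longrightarrow> B \<le> \<bar>x\<bar> \<or> B \<le> s \<Longrightarrow> P (x, s) = 0 \<and> Q (x, s) = 0"
    and supp': "\<And>x s. 0 < s \<Longrightarrow> B < \<bar>x\<bar> \<or> B < s \<Longrightarrow> P1 (x, s) + Q2 (x, s) = 0"
    and bd: "\<And>x s. 0 < s \<Longrightarrow> \<bar>P1 (x, s) + Q2 (x, s)\<bar> \<le> K"
  shows "(LINT w:UNIV \<times> {0<..}|lborel. P1 w + Q2 w) = - integral {-B..B} (\<lambda>x. Q (x, 0))"
proof -
  define \<sigma> where "\<sigma> n = B / real (n + 2)" for n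
  have \<sigma>: "0 < \<sigma> n" "\<sigma> n \<le> B" for n
    using B by (auto simp: \<sigma>_def field_simps)
  have \<sigma>0: "\<sigma> \<longlonglongrightarrow> 0"
    unfolding \<sigma>_def by (rule LIMSEQ_ignore_initial_segment[OF lim_const_over_n])
  let ?b = "\<lambda>n. cbox (-B, \<sigma> n) (B, B)"
  let ?f = "\<lambda>w. P1 w + Q2 w"
  have sub: "?b n \<subseteq> UNIV \<times> {0<..}" for n
    using \<sigma>[of n] by (auto simp: cbox_Pair_eq)
  have cf: "continuous_on (UNIV \<times> {0<..}) ?f" by (intro continuous_intros cP1 cQ2)
  have box_val: "(LINT w:?b n|lborel. ?f w) = - integral {-B..B} (\<lambda>x. Q (x, \<sigma> n))" for n
  proof -
    have cP: "continuous_on (?b n) P1" and cQb: "continuous_on (?b n) Q2"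
      using cP1 cQ2 sub continuous_on_subset by blast+
    have "(LINT w:?b n|lborel. ?f w) = integral (?b n) ?f"
      by (intro set_borel_integral_eq_integral(2), unfold set_integrable_def,
          intro borel_integrable_compact compact_cbox continuous_on_add cP cQb)
    also have "\<dots> = integral (?b n) P1 + integral (?b n) Q2"
      by (intro Henstock_Kurzweil_Integration.integral_add integrable_continuous cP cQb)
    also have "integral (?b n) P1 = integral (cbox (-B) B) (\<lambda>x. integral (cbox (\<sigma> n) B) (\<lambda>s. P1 (x, s)))"
      by (rule integral_prod_continuous[OF cP])
    also have "\<dots> = integral (cbox (\<sigma> n) B) (\<lambda>s. integral (cbox (-B) B) (\<lambda>x. P1 (x, s)))"
      using cP by (intro integral_swap_continuous) (simp add: case_prod_eta)
    also have "\<dots> = integral (cbox (\<sigma> n) B) (\<lambda>s. 0)"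
    proof (rule Henstock_Kurzweil_Integration.integral_cong)
      fix s assume "s \<in> cbox (\<sigma> n) B"
      then have s: "0 < s" using \<sigma>(1)[of n] by auto
      have "((\<lambda>x. P1 (x, s)) has_integral (P (B, s) - P (-B, s))) {-B..B}"
        using B s dP by (intro fundamental_theorem_of_calculus)
           (auto simp: has_real_derivative_iff_has_vector_derivative[symmetric] intro: has_field_derivative_at_within)
      then show "integral (cbox (-B) B) (\<lambda>x. P1 (x, s)) = 0"
        using supp s B by (simp add: integral_unique)
    qed
    also have "integral (cbox (\<sigma> n) B) (\<lambda>s. 0::real) = 0" by simp
    also have "integral (?b n) Q2 = integral (cbox (-B) B) (\<lambda>x. integral (cbox (\<sigma> n) B) (\<lambda>s. Q2 (x, s)))"
      by (rule integral_prod_continuous[OF cQb])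
    also have "\<dots> = integral (cbox (-B) B) (\<lambda>x. - Q (x, \<sigma> n))"
    proof (rule Henstock_Kurzweil_Integration.integral_cong)
      fix x
      have "((\<lambda>s. Q2 (x, s)) has_integral (Q (x, B) - Q (x, \<sigma> n))) {\<sigma> n..B}"
        using \<sigma>[of n] dQ by (intro fundamental_theorem_of_calculus)
           (auto simp: has_real_derivative_iff_has_vector_derivative[symmetric] intro: has_field_derivative_at_within)
      then show "integral (cbox (\<sigma> n) B) (\<lambda>s. Q2 (x, s)) = - Q (x, \<sigma> n)"
        using supp B by (simp add: integral_unique)
    qed
    finally show ?thesis by simp
  qed
  have "(\<lambda>n. LINT w|lborel. indicator (?b n) w * ?f w) \<longlonglongrightarrow> (LINT w|lborel. indicator (UNIV \<times> {0<..}) w * ?f w)"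
  proof (rule integral_dominated_convergence[where w="\<lambda>w. indicator (cbox (-B, 0) (B, B)) w * K"])
    show "(\<lambda>w. indicator (UNIV \<times> {0<..}) w * ?f w) \<in> borel_measurable lborel"
      using borel_measurable_continuous_on_indicator[OF _ cf]
      by (simp add: borel_prod[symmetric])
    show "(\<lambda>w. indicator (?b n) w * ?f w) \<in> borel_measurable lborel" for n
      using borel_measurable_continuous_on_indicator[OF _ continuous_on_subset[OF cf sub[of n]]]
      by simp
    show "integrable lborel (\<lambda>w. indicator (cbox (-B, 0) (B, B)) w * K)"
      by (intro integrable_mult_left integrable_real_indicator) (simp_all add: emeasure_lborel_cbox_finite[unfolded infinity_ennreal_def])
    show "AE w in lborel. (\<lambda>n. indicator (?b n) w * ?f w) \<longlonglongrightarrow> indicator (UNIV \<times> {0<..}) w * ?f w"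
    proof (rule AE_I2)
      fix w :: "real \<times> real"
      obtain x s where w: "w = (x, s)" by (cases w)
      show "(\<lambda>n. indicator (?b n) w * ?f w) \<longlonglongrightarrow> indicator (UNIV \<times> {0<..}) w * ?f w"
      proof (cases "0 < s \<and> \<bar>x\<bar> \<le> B \<and> s \<le> B")
        case True
        then have "eventually (\<lambda>n. \<sigma> n < s) sequentially"
          using order_tendstoD(2)[OF \<sigma>0] by blast
        then have "eventually (\<lambda>n. indicator (?b n) w * ?f w = indicator (UNIV \<times> {0<..}) w * ?f w) sequentially"
          by eventually_elim (use True in \<open>auto simp: w indicator_def cbox_Pair_eq abs_le_iff\<close>)
        then show ?thesis by (rule tendsto_eventually)
      next
        case False
        then have a: "indicator (?b n) w * ?f w = 0" for n
          using \<sigma>(1)[of n] by (auto simp: w indicator_def cbox_Pair_eq abs_le_iff)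
        have b: "indicator (UNIV \<times> {0<..}) w * ?f w = 0"
          using False supp' by (auto simp: w indicator_def not_le)
        show ?thesis unfolding a b by (rule tendsto_const)
      qed
    qed
    show "AE w in lborel. norm (indicator (?b n) w * ?f w) \<le> indicator (cbox (-B, 0) (B, B)) w * K" for n
      using \<sigma>[of n] bd order_trans[OF abs_ge_zero bd] by (auto simp: indicator_def cbox_Pair_eq)
  qed
  then have lim1: "(\<lambda>n. - integral {-B..B} (\<lambda>x. Q (x, \<sigma> n))) \<longlonglongrightarrow> (LINT w:UNIV \<times> {0<..}|lborel. ?f w)"
    using box_val by (simp add: set_lebesgue_integral_def)
  have "continuous_on {0..} (\<lambda>s. integral (cbox (-B) B) (\<lambda>x. Q (x, s)))"
    using cQ by (intro integral_continuous_on_param)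
      (auto simp: case_prod_beta intro!: continuous_on_compose2[OF cQ] continuous_intros)
  then have "((\<lambda>s. integral (cbox (-B) B) (\<lambda>x. Q (x, s))) \<longlongrightarrow> integral (cbox (-B) B) (\<lambda>x. Q (x, 0))) (at 0 within {0..})"
    by (auto simp: continuous_on_def)
  moreover have "filterlim \<sigma> (at 0 within {0..}) sequentially"
    using \<sigma>0 \<sigma> by (auto simp: filterlim_at less_imp_neq[symmetric] less_imp_le intro!: always_eventually)
  ultimately have "(\<lambda>n. integral (cbox (-B) B) (\<lambda>x. Q (x, \<sigma> n))) \<longlonglongrightarrow> integral (cbox (-B) B) (\<lambda>x. Q (x, 0))"
    by (rule filterlim_compose)
  then have "(\<lambda>n. - integral {-B..B} (\<lambda>x. Q (x, \<sigma> n))) \<longlonglongrightarrow> - integral {-B..B} (\<lambda>x. Q (x, 0))"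
    by (auto intro: tendsto_minus)
  then show ?thesis using lim1 LIMSEQ_unique by blast
qed

section \<open>The divergence theorem in a boundary patch\<close>

text \<open>
The divergence of a plane vector field is this trace of its derivative.
\<close>
definition trace2 :: "(real \<times> real \<Rightarrow> real \<times> real) \<Rightarrow> real" where
  "trace2 L = fst (L (1, 0)) + snd (L (0, 1))"

lemma trace2_orthonormal:
  assumes L: "linear L" and uv: "norm u = 1" "norm v = 1" "u \<bullet> v = 0"
  shows "L u \<bullet> u + L v \<bullet> v = trace2 L"
proof -
  obtain c s e where 1: "c\<^sup>2 + s\<^sup>2 = 1" "e = 1 \<or> e = -1" "u = (c, s)" "v = (- e * s, e * c)"
    using orthonormal_pair_coords[OF uv] .
  have lin: "L (p, q) = p *\<^sub>R L (1, 0) + q *\<^sub>R L (0, 1)" for p q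
  proof -
    have "L (p, q) = L (p *\<^sub>R (1, 0) + q *\<^sub>R (0, 1))" by simp
    also have "\<dots> = p *\<^sub>R L (1, 0) + q *\<^sub>R L (0, 1)"
      by (simp only: linear_add[OF L] linear_scale[OF L])
    finally show ?thesis .
  qed
  obtain \<alpha> \<beta> where L1: "L (1, 0) = (\<alpha>, \<beta>)" by (cases "L (1, 0)")
  obtain \<gamma> \<delta> where L2: "L (0, 1) = (\<gamma>, \<delta>)" by (cases "L (0, 1)")
  have "e\<^sup>2 = 1" using 1(2) by auto
  have "L u \<bullet> u + L v \<bullet> v =
      (c * \<alpha> + s * \<gamma>) * c + (c * \<beta> + s * \<delta>) * s
      + ((- e * s) * \<alpha> + e * c * \<gamma>) * (- e * s) + ((- e * s) * \<beta> + e * c * \<delta>) * (e * c)"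
    unfolding 1 lin[of c s] lin[of "- e * s" "e * c"] L1 L2 by simp
  also have "\<dots> = c\<^sup>2 * \<alpha> + s * c * \<gamma> + c * s * \<beta> + s\<^sup>2 * \<delta>
      + e\<^sup>2 * (s\<^sup>2 * \<alpha> - s * c * \<gamma> - s * c * \<beta> + c\<^sup>2 * \<delta>)"
    by (simp add: algebra_simps power2_eq_square)
  also have "\<dots> = (c\<^sup>2 + s\<^sup>2) * (\<alpha> + \<delta>)"
    unfolding \<open>e\<^sup>2 = 1\<close> by (simp add: algebra_simps)
  also have "\<dots> = \<alpha> + \<delta>" by (simp add: 1(1))
  finally show ?thesis by (simp add: trace2_def L1 L2)
qed

lemma graph_patch_closure:
  fixes \<Omega> :: "'a::real_inner set"
  assumes uv: "u \<bullet> v = 0" "norm v = 1" and cg: "continuous_on UNIV g"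
    and graph: "\<Omega> \<inter> ball a r = {w \<in> ball a r. g (w \<bullet> u) < w \<bullet> v}"
    and w: "w \<in> ball a r"
  shows "w \<in> closure \<Omega> \<longleftrightarrow> g (w \<bullet> u) \<le> w \<bullet> v"
proof
  assume cl: "w \<in> closure \<Omega>"
  show "g (w \<bullet> u) \<le> w \<bullet> v"
  proof (rule ccontr)
    assume neg: "\<not> g (w \<bullet> u) \<le> w \<bullet> v"
    let ?U = "ball a r \<inter> {w. w \<bullet> v < g (w \<bullet> u)}"
    have "open ?U"
      by (intro open_Int open_ball open_Collect_less continuous_intros continuous_on_compose2[OF cg]) auto
    moreover have "?U \<inter> \<Omega> = {}"
    proof -
      have False if "w' \<in> ?U" "w' \<in> \<Omega>" for w'
      proof -
        have "w' \<in> {w \<in> ball a r. g (w \<bullet> u) < w \<bullet> v}" using graph that by blast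
        with that(1) show False by simp
      qed
      then show ?thesis by blast
    qed
    ultimately have "?U \<inter> closure \<Omega> = {}" by (simp add: open_Int_closure_eq_empty)
    with cl w neg show False by auto
  qed
next
  assume le: "g (w \<bullet> u) \<le> w \<bullet> v"
  have vv: "v \<bullet> u = 0" "v \<bullet> v = 1" using uv by (auto simp: norm_eq_1 inner_commute)
  have conv: "((\<lambda>t. w + t *\<^sub>R v) \<longlongrightarrow> w) (at_right 0)"
    by (auto intro!: tendsto_eq_intros)
  have "((\<lambda>t. dist a (w + t *\<^sub>R v)) \<longlongrightarrow> dist a w) (at_right 0)"
    by (intro tendsto_intros conv)
  then have "eventually (\<lambda>t. dist a (w + t *\<^sub>R v) < r) (at_right 0)"
    using w by (intro order_tendstoD) auto
  moreover have "eventually (\<lambda>t::real. 0 < t) (at_right 0)" by (simp add: eventually_at_filter)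
  ultimately have "eventually (\<lambda>t. w + t *\<^sub>R v \<in> closure \<Omega>) (at_right 0)"
  proof eventually_elim
    case (elim t)
    then have "w + t *\<^sub>R v \<in> {w \<in> ball a r. g (w \<bullet> u) < w \<bullet> v}"
      using le vv by (simp add: inner_add_left)
    then show ?case using graph closure_subset by blast
  qed
  then show "w \<in> closure \<Omega>" by (intro Lim_in_closed_set[OF _ _ _ conv]) auto
qed

lemma graph_patch_frontier:
  fixes \<Omega> :: "'a::real_inner set"
  assumes "open \<Omega>" and uv: "u \<bullet> v = 0" "norm v = 1" and cg: "continuous_on UNIV g"
    and graph: "\<Omega> \<inter> ball a r = {w \<in> ball a r. g (w \<bullet> u) < w \<bullet> v}"
    and w: "w \<in> ball a r"
  shows "w \<in> frontier \<Omega> \<longleftrightarrow> w \<bullet> v = g (w \<bullet> u)"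
proof -
  have "w \<in> \<Omega> \<longleftrightarrow> g (w \<bullet> u) < w \<bullet> v" using graph w by blast
  then show ?thesis
    using graph_patch_closure[OF uv cg graph w] \<open>open \<Omega>\<close>
    by (auto simp: frontier_def interior_open)
qed

text \<open>
The divergence theorem for a field supported in one boundary patch. In the coordinates
\<open>\<Psi> (x, s) = x u + (s + g x) v\<close> the divergence of \<open>Y\<close> is \<open>P\<^sub>x + Q\<^sub>s\<close> with \<open>P = Y \<bullet> u\<close> and
\<open>Q = Y \<bullet> v - g' (Y \<bullet> u)\<close>, so the half-plane case applies. The vector \<open>v - g' u\<close> is the inner
normal of the graph scaled to length \<open>sqrt (1 + g'\<^sup>2)\<close>, the density of arc length.
\<close>
lemma graph_patch_divergence:
  fixes \<Omega> :: "(real \<times> real) set" and Y :: "real \<times> real \<Rightarrow> real \<times> real"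
  assumes op: "open \<Omega>" and uv: "norm u = 1" "norm v = 1" "u \<bullet> v = 0"
    and dg: "\<And>x. (g has_real_derivative g' x) (at x)" and cg': "continuous_on UNIV g'"
    and \<rho>: "0 < \<rho>" "\<rho> < r"
    and graph: "\<Omega> \<inter> ball a r = {w \<in> ball a r. g (w \<bullet> u) < w \<bullet> v}"
    and cY: "continuous_on (closure \<Omega>) Y"
    and supp: "\<And>w. \<rho> \<le> dist a w \<Longrightarrow> Y w = 0"
    and dY: "\<And>w. w \<in> \<Omega> \<Longrightarrow> (Y has_derivative Y' w) (at w)"
    and cY': "\<And>h. continuous_on \<Omega> (\<lambda>w. Y' w h)"
    and bd: "\<And>w. w \<in> \<Omega> \<Longrightarrow> \<bar>trace2 (Y' w)\<bar> \<le> K"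
  obtains B where "0 < B"
    and "(LINT w:\<Omega>|lborel. trace2 (Y' w)) =
      - integral {-B..B} (\<lambda>x. Y (x *\<^sub>R u + g x *\<^sub>R v) \<bullet> v - g' x * (Y (x *\<^sub>R u + g x *\<^sub>R v) \<bullet> u))"
    and "continuous_on {-B..B} (\<lambda>x. Y (x *\<^sub>R u + g x *\<^sub>R v) \<bullet> v - g' x * (Y (x *\<^sub>R u + g x *\<^sub>R v) \<bullet> u))"
proof -
  define \<Psi> where "\<Psi> = (\<lambda>(x, s). x *\<^sub>R u + (s + g x) *\<^sub>R v)"
  have uu: "u \<bullet> u = 1" "v \<bullet> v = 1" "v \<bullet> u = 0"
    using uv by (auto simp: norm_eq_1 inner_commute)
  have \<Psi>u: "\<Psi> (x, s) \<bullet> u = x" and \<Psi>v: "\<Psi> (x, s) \<bullet> v = s + g x" for x s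
    using uu uv by (auto simp: \<Psi>_def inner_add_left)
  have cg: "continuous_on UNIV g"
    using dg by (meson DERIV_continuous continuous_at_imp_continuous_on)
  have c\<Psi>: "continuous_on A \<Psi>" for A
    unfolding \<Psi>_def case_prod_beta
    by (intro continuous_intros continuous_on_compose2[OF cg]) auto
  define B0 where "B0 = norm a + \<rho>"
  obtain G where G: "\<And>x. \<bar>x\<bar> \<le> B0 \<Longrightarrow> \<bar>g x\<bar> \<le> G"
  proof -
    have "compact (g ` {-B0..B0})"
      by (intro compact_continuous_image continuous_on_subset[OF cg]) auto
    then have "bounded (g ` {-B0..B0})" by (rule compact_imp_bounded)
    then obtain G where "\<And>y. y \<in> g ` {-B0..B0} \<Longrightarrow> norm y \<le> G" unfolding bounded_iff by blast
    then show thesis by (intro that[of G]) (auto simp: abs_le_iff)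
  qed
  \<comment> \<open>The summand 1 makes the fact \<open>far\<close> below strict, so that the derivative of \<open>Y\<close> vanishes there as well.\<close>
  define B where "B = B0 + \<bar>G\<bar> + 1"
  have B: "0 < B" using \<rho> by (simp add: B_def B0_def add_pos_nonneg add_nonneg_pos)
  have far: "\<rho> < dist a (\<Psi> (x, s))" if "B \<le> \<bar>x\<bar> \<or> B \<le> s" for x s
  proof -
    have "B0 < norm (\<Psi> (x, s))"
    proof (cases "B0 < \<bar>x\<bar>")
      case True
      have "\<bar>\<Psi> (x, s) \<bullet> u\<bar> \<le> norm (\<Psi> (x, s)) * norm u" by (rule Cauchy_Schwarz_ineq2)
      with True show ?thesis by (simp add: \<Psi>u uv)
    next
      case False
      with that have s: "B \<le> s" by (auto simp: B_def)
      have "\<bar>\<Psi> (x, s) \<bullet> v\<bar> \<le> norm (\<Psi> (x, s)) * norm v" by (rule Cauchy_Schwarz_ineq2)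
      then have "\<bar>s + g x\<bar> \<le> norm (\<Psi> (x, s))" by (simp add: \<Psi>v uv)
      moreover have "\<bar>g x\<bar> \<le> G" using False G by auto
      ultimately show ?thesis using s by (auto simp: B_def)
    qed
    then show ?thesis
      using norm_triangle_ineq2[of "\<Psi> (x, s)" a] by (simp add: B0_def dist_norm norm_minus_commute)
  qed
  define D where "D = \<Omega> \<union> - cball a \<rho>"
  \<comment> \<open>This is the derivative of \<open>Y\<close> on all of \<open>D\<close>, hence at every \<open>\<Psi> (x, s)\<close> with \<open>s > 0\<close>, even where that point lies outside of \<open>\<Omega>\<close>.\<close>
  define Z' where "Z' w = (if \<rho> < dist a w then (\<lambda>h. 0) else Y' w)" for w
  have far_der: "(Y has_derivative (\<lambda>h. 0)) (at w)" if "\<rho> < dist a w" for w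
  proof (rule has_derivative_transform_within_open[OF has_derivative_const[of 0], where s="- cball a \<rho>"])
    show "0 = Y x" if "x \<in> - cball a \<rho>" for x using that supp by simp
  qed (use that in auto)
  have Z'\<Omega>: "Z' w = Y' w" if "w \<in> \<Omega>" for w
    using far_der[of w] dY[OF that] has_derivative_unique by (auto simp: Z'_def)
  have dZ: "(Y has_derivative Z' w) (at w)" if "w \<in> D" for w
    using that far_der[of w] dY[of w] by (auto simp: D_def Z'_def)
  have cZ: "continuous_on D (\<lambda>w. Z' w h)" for h
    unfolding D_def
  proof (rule continuous_on_open_Un)
    show "continuous_on \<Omega> (\<lambda>w. Z' w h)"
      using cY'[of h] by (rule continuous_on_eq) (simp add: Z'\<Omega>)
    show "continuous_on (- cball a \<rho>) (\<lambda>w. Z' w h)"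
      by (rule continuous_on_eq[of _ "\<lambda>w. 0"]) (auto simp: Z'_def)
  qed (use op in auto)
  have in\<Omega>: "\<Psi> (x, s) \<in> \<Omega>" if "0 < s" "dist a (\<Psi> (x, s)) < r" for x s
  proof -
    have "\<Psi> (x, s) \<in> {w \<in> ball a r. g (w \<bullet> u) < w \<bullet> v}"
      using that by (simp add: \<Psi>u \<Psi>v)
    then show ?thesis using graph by blast
  qed
  have inD: "\<Psi> (x, s) \<in> D" if "0 < s" for x s
    using in\<Omega>[OF that, of x] \<rho> by (force simp: D_def)
  have incl: "\<Psi> (x, s) \<in> closure \<Omega>" if s: "0 \<le> s" and d: "dist a (\<Psi> (x, s)) < r" for x s
    using graph_patch_closure[OF uv(3,2) cg graph, of "\<Psi> (x, s)"] that by (simp add: \<Psi>u \<Psi>v)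
  have cYF: "continuous_on (closure \<Omega> \<union> - ball a \<rho>) Y"
    by (intro continuous_on_closed_Un cY continuous_on_eq[of "- ball a \<rho>" "\<lambda>w. 0" Y])
       (auto simp: supp)
  have cY\<Psi>: "continuous_on (UNIV \<times> {0..}) (\<lambda>w. Y (\<Psi> w))"
  proof (rule continuous_on_compose2[OF cYF c\<Psi>], rule image_subsetI)
    have "\<Psi> (x, s) \<in> closure \<Omega> \<union> - ball a \<rho>" if "0 \<le> s" for x s
      using incl[OF that, of x] \<rho> by (cases "dist a (\<Psi> (x, s)) < r") auto
    then show "\<Psi> w \<in> closure \<Omega> \<union> - ball a \<rho>" if "w \<in> UNIV \<times> {0..}" for w
      using that by (cases w) blast
  qed
  have cZ\<Psi>: "continuous_on (UNIV \<times> {0<..}) (\<lambda>w. Z' (\<Psi> w) h)" for h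
  proof (rule continuous_on_compose2[OF cZ c\<Psi>], rule image_subsetI)
    show "\<Psi> w \<in> D" if "w \<in> UNIV \<times> {0<..}" for w
      using that inD by (cases w) blast
  qed
  have cg'1: "continuous_on A (\<lambda>w::real \<times> real. g' (fst w))" for A
    by (intro continuous_on_compose2[OF cg'] continuous_intros) auto
  let ?P = "\<lambda>w. Y (\<Psi> w) \<bullet> u"
  let ?Q = "\<lambda>w. Y (\<Psi> w) \<bullet> v - g' (fst w) * (Y (\<Psi> w) \<bullet> u)"
  let ?P1 = "\<lambda>w. Z' (\<Psi> w) u \<bullet> u + g' (fst w) * (Z' (\<Psi> w) v \<bullet> u)"
  let ?Q2 = "\<lambda>w. Z' (\<Psi> w) v \<bullet> v - g' (fst w) * (Z' (\<Psi> w) v \<bullet> u)"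
  have linZ: "linear (Z' (\<Psi> (x, s)))" if "0 < s" for x s
    using dZ[OF inD[OF that]] has_derivative_linear by blast
  have tr: "?P1 (x, s) + ?Q2 (x, s) = trace2 (Z' (\<Psi> (x, s)))" if "0 < s" for x s
    using trace2_orthonormal[OF linZ[OF that] uv] by simp
  have half: "(LINT w:UNIV \<times> {0<..}|lborel. ?P1 w + ?Q2 w) = - integral {-B..B} (\<lambda>x. ?Q (x, 0))"
  proof (rule half_plane_divergence[OF B, where P="?P" and K="\<bar>K\<bar>"])
    fix x s :: real assume s: "0 < s"
    have d\<Psi>x: "((\<lambda>x. \<Psi> (x, s)) has_derivative (\<lambda>h. h *\<^sub>R u + (g' x * h) *\<^sub>R v)) (at x)"
      unfolding \<Psi>_def prod.case
      by (auto intro!: derivative_eq_intros dg[unfolded has_field_derivative_def])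
    have "((\<lambda>x. Y (\<Psi> (x, s)) \<bullet> u) has_derivative
        (\<lambda>h. Z' (\<Psi> (x, s)) (h *\<^sub>R u + (g' x * h) *\<^sub>R v) \<bullet> u)) (at x)"
      using has_derivative_compose[OF d\<Psi>x dZ[OF inD[OF s]]] by (rule has_derivative_inner_left)
    moreover have "Z' (\<Psi> (x, s)) (h *\<^sub>R u + (g' x * h) *\<^sub>R v) \<bullet> u = ?P1 (x, s) * h" for h
      using linZ[OF s, of x]
      by (simp add: linear_add linear_scale inner_add_left algebra_simps)
    ultimately show "((\<lambda>x. ?P (x, s)) has_real_derivative ?P1 (x, s)) (at x)"
      by (simp add: has_field_derivative_def)
    have d\<Psi>s: "((\<lambda>s. \<Psi> (x, s)) has_derivative (\<lambda>h. h *\<^sub>R v)) (at s)"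
      unfolding \<Psi>_def prod.case by (auto intro!: derivative_eq_intros)
    have Yv: "((\<lambda>s. Y (\<Psi> (x, s))) has_derivative (\<lambda>h. Z' (\<Psi> (x, s)) (h *\<^sub>R v))) (at s)"
      by (rule has_derivative_compose[OF d\<Psi>s dZ[OF inD[OF s]]])
    have "((\<lambda>s. ?Q (x, s)) has_derivative (\<lambda>h. Z' (\<Psi> (x, s)) (h *\<^sub>R v) \<bullet> v
        - g' x * (Z' (\<Psi> (x, s)) (h *\<^sub>R v) \<bullet> u))) (at s)"
      by (auto intro!: derivative_eq_intros Yv)
    moreover have "Z' (\<Psi> (x, s)) (h *\<^sub>R v) \<bullet> v - g' x * (Z' (\<Psi> (x, s)) (h *\<^sub>R v) \<bullet> u)
        = ?Q2 (x, s) * h" for h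
      using linZ[OF s, of x] by (simp add: linear_scale algebra_simps)
    ultimately show "((\<lambda>s. ?Q (x, s)) has_real_derivative ?Q2 (x, s)) (at s)"
      by (simp add: has_field_derivative_def)
    show "?P (x, s) = 0 \<and> ?Q (x, s) = 0" if "B \<le> \<bar>x\<bar> \<or> B \<le> s"
      using supp[OF less_imp_le[OF far[OF that]]] by simp
    show "?P1 (x, s) + ?Q2 (x, s) = 0" if "B < \<bar>x\<bar> \<or> B < s"
      using far[of x s] that by (auto simp: Z'_def)
    have "\<bar>trace2 (Z' (\<Psi> (x, s)))\<bar> \<le> \<bar>K\<bar>"
    proof (cases "\<Psi> (x, s) \<in> \<Omega>")
      case True
      then show ?thesis using bd[OF True] Z'\<Omega>[OF True] by auto
    next
      case False
      then have "\<rho> < dist a (\<Psi> (x, s))" using in\<Omega>[OF s, of x] \<rho> by force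
      then show ?thesis by (simp add: Z'_def trace2_def)
    qed
    then show "\<bar>?P1 (x, s) + ?Q2 (x, s)\<bar> \<le> \<bar>K\<bar>" using tr[OF s] by simp
  qed (intro continuous_intros cZ\<Psi> cY\<Psi> cg'1)+
  have c\<Omega>: "continuous_on \<Omega> (\<lambda>w. trace2 (Y' w))"
    unfolding trace2_def by (intro continuous_intros cY')
  have "(LINT w:\<Omega>|lborel. trace2 (Y' w)) = (LINT w|distr lborel borel \<Psi>. indicator \<Omega> w * trace2 (Y' w))"
    unfolding \<Psi>_def by (simp add: distr_lborel_graph_coords[OF uv cg] set_lebesgue_integral_def)
  also have "\<dots> = (LINT w|lborel. indicator \<Omega> (\<Psi> w) * trace2 (Y' (\<Psi> w)))"
  proof (rule integral_distr)
    show "\<Psi> \<in> measurable lborel borel" using borel_measurable_continuous_onI[OF c\<Psi>] by simp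
    show "(\<lambda>w. indicator \<Omega> w * trace2 (Y' w)) \<in> borel_measurable borel"
      using borel_measurable_continuous_on_indicator[OF _ c\<Omega>] op by simp
  qed
  also have "\<dots> = (LINT w:UNIV \<times> {0<..}|lborel. ?P1 w + ?Q2 w)"
    unfolding set_lebesgue_integral_def
  proof (rule Bochner_Integration.integral_cong[OF refl])
    fix w :: "real \<times> real"
    obtain x s where w: "w = (x, s)" by (cases w)
    show "indicator \<Omega> (\<Psi> w) * trace2 (Y' (\<Psi> w)) = indicator (UNIV \<times> {0<..}) w *\<^sub>R (?P1 w + ?Q2 w)"
    proof (cases "0 < s")
      case True
      have "indicator \<Omega> (\<Psi> (x, s)) * trace2 (Y' (\<Psi> (x, s))) = trace2 (Z' (\<Psi> (x, s)))"
      proof (cases "\<Psi> (x, s) \<in> \<Omega>")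
        case True
        then show ?thesis by (simp add: Z'\<Omega>)
      next
        case False
        then have "\<rho> < dist a (\<Psi> (x, s))" using in\<Omega>[OF \<open>0 < s\<close>, of x] \<rho> by force
        then show ?thesis using False by (simp add: Z'_def trace2_def)
      qed
      then show ?thesis using True tr[OF True] unfolding w by simp
    next
      case False
      have "trace2 (Y' (\<Psi> (x, s))) = 0" if "\<Psi> (x, s) \<in> \<Omega>"
      proof -
        have "\<Psi> (x, s) \<notin> {w \<in> ball a r. g (w \<bullet> u) < w \<bullet> v}"
          using False by (simp add: \<Psi>u \<Psi>v)
        then have "r \<le> dist a (\<Psi> (x, s))" using that graph by force
        then have "Z' (\<Psi> (x, s)) = (\<lambda>h. 0)" using \<rho> by (simp add: Z'_def)
        then show ?thesis using Z'\<Omega>[OF that] by (simp add: trace2_def)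
      qed
      then show ?thesis using False by (auto simp: w indicator_def)
    qed
  qed
  finally have main: "(LINT w:\<Omega>|lborel. trace2 (Y' w)) = - integral {-B..B} (\<lambda>x. ?Q (x, 0))"
    using half by simp
  have \<Psi>0: "\<Psi> (x, 0) = x *\<^sub>R u + g x *\<^sub>R v" for x by (simp add: \<Psi>_def)
  have "continuous_on {-B..B} (\<lambda>x. Y (\<Psi> (x, 0)))"
    by (rule continuous_on_compose2[OF cY\<Psi>]) (auto intro!: continuous_intros)
  then have cQ0: "continuous_on {-B..B} (\<lambda>x. ?Q (x, 0))"
    by (intro continuous_intros) (simp_all add: continuous_on_subset[OF cg' subset_UNIV])
  show thesis
    by (rule that[OF B main[unfolded \<Psi>0 fst_conv] cQ0[unfolded \<Psi>0 fst_conv]])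
qed

section \<open>Coverings of graphs and Hausdorff measure\<close>

lemma graph_chord:
  fixes u v :: "'a::real_inner" and g :: "real \<Rightarrow> real"
  assumes uv: "norm u = 1" "norm v = 1" "u \<bullet> v = 0"
    and dg: "\<And>x. (g has_real_derivative g' x) (at x)"
  obtains \<xi> where "min x y \<le> \<xi>" "\<xi> \<le> max x y"
    "dist (x *\<^sub>R u + g x *\<^sub>R v) (y *\<^sub>R u + g y *\<^sub>R v) = \<bar>x - y\<bar> * sqrt (1 + (g' \<xi>)\<^sup>2)"
proof -
  have "\<exists>\<xi>. min x y \<le> \<xi> \<and> \<xi> \<le> max x y \<and> g x - g y = g' \<xi> * (x - y)"
  proof (induction x y rule: linorder_wlog)
    case (le x y)
    show ?case
    proof (cases "x = y")
      case False
      with le have "x < y" by simp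
      from MVT2[OF this, of g g'] obtain z where "x < z" "z < y" "g y - g x = (y - x) * g' z"
        using dg by blast
      then show ?thesis by (intro exI[of _ z]) (auto simp: algebra_simps)
    qed auto
  next
    case (sym x y)
    then obtain \<xi> where \<xi>: "min y x \<le> \<xi>" "\<xi> \<le> max y x" "g y - g x = g' \<xi> * (y - x)"
      by blast
    have "g x - g y = g' \<xi> * (x - y)" using \<xi>(3) by (simp add: right_diff_distrib)
    moreover have "min x y = min y x" "max x y = max y x" by (simp_all add: min.commute max.commute)
    ultimately show ?case using \<xi>(1,2) by (intro exI[of _ \<xi>]) simp
  qed
  then obtain \<xi> where \<xi>: "min x y \<le> \<xi>" "\<xi> \<le> max x y" "g x - g y = g' \<xi> * (x - y)" by blast
  have uu: "u \<bullet> u = 1" "v \<bullet> v = 1" "v \<bullet> u = 0" using uv by (auto simp: norm_eq_1 inner_commute)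
  have "(x *\<^sub>R u + g x *\<^sub>R v) - (y *\<^sub>R u + g y *\<^sub>R v) = (x - y) *\<^sub>R u + (g x - g y) *\<^sub>R v"
    by (simp add: algebra_simps)
  then have "(x *\<^sub>R u + g x *\<^sub>R v) - (y *\<^sub>R u + g y *\<^sub>R v) = (x - y) *\<^sub>R (u + g' \<xi> *\<^sub>R v)"
    unfolding \<xi>(3) by (simp add: scaleR_add_right mult.commute)
  moreover have "norm (u + g' \<xi> *\<^sub>R v) = sqrt (1 + (g' \<xi>)\<^sup>2)"
    using uu uv(3) by (simp add: norm_eq_sqrt_inner inner_add_left inner_add_right power2_eq_square)
  ultimately show thesis using \<xi>(1,2) by (intro that[of \<xi>]) (simp_all add: dist_norm)
qed

lemma orthonormal_expansion:
  fixes u v w :: "real \<times> real"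
  assumes "norm u = 1" "norm v = 1" "u \<bullet> v = 0"
  shows "w = (w \<bullet> u) *\<^sub>R u + (w \<bullet> v) *\<^sub>R v"
proof -
  obtain c s e where 1: "c\<^sup>2 + s\<^sup>2 = 1" "e = 1 \<or> e = -1" "u = (c, s)" "v = (- e * s, e * c)"
    using orthonormal_pair_coords[OF assms] .
  obtain p q where w: "w = (p, q)" by (cases w)
  have e: "e\<^sup>2 = 1" using 1(2) by auto
  have "(p * c + q * s) * c + (p * (- e * s) + q * (e * c)) * (- e * s)
      = p * c\<^sup>2 + q * s * c + e\<^sup>2 * (p * s\<^sup>2 - q * c * s)"
    by (simp add: algebra_simps power2_eq_square)
  also have "\<dots> = p * (c\<^sup>2 + s\<^sup>2)" unfolding e by (simp add: algebra_simps)
  finally have "(p * c + q * s) * c + (p * (- e * s) + q * (e * c)) * (- e * s) = p"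
    by (simp add: 1(1))
  moreover have "(p * c + q * s) * s + (p * (- e * s) + q * (e * c)) * (e * c)
      = p * c * s + q * s\<^sup>2 + e\<^sup>2 * (q * c\<^sup>2 - p * s * c)"
    by (simp add: algebra_simps power2_eq_square)
  then have "(p * c + q * s) * s + (p * (- e * s) + q * (e * c)) * (e * c) = q * (c\<^sup>2 + s\<^sup>2)"
    unfolding e by (simp add: algebra_simps)
  then have "(p * c + q * s) * s + (p * (- e * s) + q * (e * c)) * (e * c) = q"
    by (simp add: 1(1))
  ultimately show ?thesis by (simp add: w 1(3,4))
qed

text \<open>
Arc length is compared with coverings directly, without treating Hausdorff measure as a measure. If
a set of small diameter \<open>d\<close> meets the graph, the parameters of the common points lie in an interval
\<open>J\<close>; a chord of the graph over \<open>J\<close> has length \<open>\<bar>J\<bar> sqrt (1 + g'(\<xi>)\<^sup>2)\<close>, and since \<open>g'\<close> hardly varies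
on \<open>J\<close>, the integral of \<open>sqrt (1 + g'\<^sup>2)\<close> over \<open>J\<close> is at most \<open>(1 + \<epsilon>)\<^sup>2 d\<close>. The weight \<open>\<eta>\<close> hardly
varies on the set either, so it may be evaluated at any point \<open>c i\<close> of the set on \<open>S\<close>. These points
are not chosen here, because the estimates of several patches have to be added with the same points.
\<close>
lemma graph_cover_estimate:
  fixes u v :: "'a::real_inner" and g :: "real \<Rightarrow> real" and \<eta> :: "'a \<Rightarrow> real"
  defines "\<gamma> \<equiv> \<lambda>x. x *\<^sub>R u + g x *\<^sub>R v"
  assumes uv: "norm u = 1" "norm v = 1" "u \<bullet> v = 0"
    and dg: "\<And>x. (g has_real_derivative g' x) (at x)" and cg': "continuous_on UNIV g'"
    and S: "compact S" and c\<eta>: "continuous_on S \<eta>" and \<eta>0: "\<And>w. w \<in> S \<Longrightarrow> 0 \<le> \<eta> w"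
    and M: "0 \<le> M" and \<epsilon>: "0 < \<epsilon>"
    and cq: "continuous_on {-B..B} q"
    and q: "\<And>x. x \<in> {-B..B} \<Longrightarrow> q x \<noteq> 0 \<Longrightarrow> \<gamma> x \<in> S \<and> \<bar>q x\<bar> \<le> M * sqrt (1 + (g' x)\<^sup>2) * \<eta> (\<gamma> x)"
  obtains \<delta> where "0 < \<delta>"
    and "\<And>C c. S \<subseteq> (\<Union>i::nat. C i) \<Longrightarrow> (\<And>i. bounded (C i)) \<Longrightarrow> (\<And>i. diameter (C i) \<le> \<delta>) \<Longrightarrow>
      (\<And>i. c i \<in> S) \<Longrightarrow> (\<And>i. C i \<inter> S \<noteq> {} \<Longrightarrow> c i \<in> C i) \<Longrightarrow>
      ennreal \<bar>integral {-B..B} q\<bar> \<le> (\<Sum>i. ennreal (M * (1 + \<epsilon>)\<^sup>2 * (\<eta> (c i) + \<epsilon>)) * ennreal (diameter (C i)))"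
proof -
  define A where "A x = sqrt (1 + (g' x)\<^sup>2)" for x
  have A1: "1 \<le> A x" for x by (simp add: A_def)
  have cA: "continuous_on {-B..B} A"
    unfolding A_def by (intro continuous_intros continuous_on_subset[OF cg' subset_UNIV])
  obtain \<delta>1 where \<delta>1: "0 < \<delta>1" "\<And>w w'. w \<in> S \<Longrightarrow> w' \<in> S \<Longrightarrow> dist w' w < \<delta>1 \<Longrightarrow> dist (\<eta> w') (\<eta> w) < \<epsilon>"
    using compact_uniformly_continuous[OF c\<eta> S] \<epsilon> unfolding uniformly_continuous_on_def by metis
  obtain \<delta>2 where \<delta>2: "0 < \<delta>2"
    "\<And>x y. x \<in> {-B..B} \<Longrightarrow> y \<in> {-B..B} \<Longrightarrow> dist y x < \<delta>2 \<Longrightarrow> dist (A y) (A x) < \<epsilon>"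
    using compact_uniformly_continuous[OF cA compact_Icc] \<epsilon> unfolding uniformly_continuous_on_def by metis
  define \<delta> where "\<delta> = min \<delta>1 \<delta>2 / 2"
  have \<delta>: "0 < \<delta>" "\<delta> < \<delta>1" "\<delta> < \<delta>2" using \<delta>1(1) \<delta>2(1) by (auto simp: \<delta>_def)
  have A\<epsilon>: "A y \<le> (1 + \<epsilon>) * A x" if "x \<in> {-B..B}" "y \<in> {-B..B}" "\<bar>y - x\<bar> \<le> \<delta>" for x y
  proof -
    have "A y \<le> A x + \<epsilon>" using \<delta>2(2)[OF that(1,2)] that(3) \<delta> by (auto simp: dist_real_def)
    also have "\<epsilon> \<le> \<epsilon> * A x" using A1[of x] \<epsilon> by simp
    finally show ?thesis by (simp add: algebra_simps)
  qed
  show thesis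
  proof (rule that[OF \<delta>(1)])
    fix C :: "nat \<Rightarrow> 'a set" and c
    assume cov: "S \<subseteq> (\<Union>i. C i)" and bC: "\<And>i. bounded (C i)" and dC: "\<And>i. diameter (C i) \<le> \<delta>"
      and cS: "\<And>i. c i \<in> S" and cC: "\<And>i. C i \<inter> S \<noteq> {} \<Longrightarrow> c i \<in> C i"
    define X where "X i = {x \<in> {-B..B}. q x \<noteq> 0 \<and> \<gamma> x \<in> C i}" for i
    define J where "J i = (if X i = {} then {} else {Inf (X i)..Sup (X i)})" for i
    define \<alpha> where "\<alpha> i = A (SOME x. x \<in> X i)" for i
    define s where "s i = M * ((1 + \<epsilon>) * \<alpha> i) * (\<eta> (c i) + \<epsilon>)" for i
    have bX: "bdd_above (X i)" "bdd_below (X i)" for i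
      by (rule bdd_above_mono[of "{-B..B}"] bdd_below_mono[of "{-B..B}"]; auto simp: X_def)+
    have dist\<gamma>: "dist (\<gamma> x) (\<gamma> y) \<le> diameter (C i)" if "x \<in> X i" "y \<in> X i" for x y i
      using that by (intro diameter_bounded_bound bC) (auto simp: X_def)
    have chord: "\<exists>\<xi>. min x y \<le> \<xi> \<and> \<xi> \<le> max x y \<and> dist (\<gamma> x) (\<gamma> y) = \<bar>x - y\<bar> * A \<xi>" for x y
      unfolding \<gamma>_def A_def using graph_chord[OF uv dg, of x y] by metis
    have close: "\<bar>x - y\<bar> \<le> \<delta>" if xy: "x \<in> X i" "y \<in> X i" for x y i
    proof -
      obtain \<xi> where \<xi>: "dist (\<gamma> x) (\<gamma> y) = \<bar>x - y\<bar> * A \<xi>" using chord by blast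
      have "\<bar>x - y\<bar> \<le> \<bar>x - y\<bar> * A \<xi>"
        using mult_left_mono[OF A1[of \<xi>], of "\<bar>x - y\<bar>"] by simp
      also have "\<dots> \<le> diameter (C i)" using dist\<gamma>[OF xy] \<xi> by simp
      also have "\<dots> \<le> \<delta>" by (rule dC)
      finally show ?thesis .
    qed
    have pick: "(SOME x. x \<in> X i) \<in> X i" if "x \<in> X i" for x i using that by (rule someI)
    have \<alpha>1: "1 \<le> \<alpha> i" for i by (simp add: \<alpha>_def A1)
    have s0: "0 \<le> s i" for i
      using M \<epsilon> \<alpha>1[of i] \<eta>0[OF cS[of i]] by (simp add: s_def)
    have XB: "x \<in> {-B..B}" if "x \<in> X i" for x i using that by (simp add: X_def)
    have pt: "ennreal \<bar>q x\<bar> * indicator {-B..B} x \<le> (\<Sum>i. ennreal (s i) * indicator (J i) x)" for x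
    proof (cases "x \<in> {-B..B} \<and> q x \<noteq> 0")
      case True
      then have qx: "\<gamma> x \<in> S" "\<bar>q x\<bar> \<le> M * A x * \<eta> (\<gamma> x)" using q by (auto simp: A_def)
      then obtain i where i: "\<gamma> x \<in> C i" using cov by blast
      then have x: "x \<in> X i" using True by (simp add: X_def)
      have "c i \<in> C i" using i qx(1) cC by blast
      then have "dist (\<gamma> x) (c i) \<le> diameter (C i)" using i by (intro diameter_bounded_bound bC)
      then have "dist (\<eta> (\<gamma> x)) (\<eta> (c i)) < \<epsilon>"
        using dC[of i] \<delta> by (intro \<delta>1(2) cS qx(1)) linarith
      then have \<eta>x: "\<eta> (\<gamma> x) \<le> \<eta> (c i) + \<epsilon>" by (auto simp: dist_real_def)
      have Ax: "A x \<le> (1 + \<epsilon>) * \<alpha> i"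
        unfolding \<alpha>_def by (intro A\<epsilon> XB[OF x] XB[OF pick[OF x]] close[OF x pick[OF x]])
      have "M * A x * \<eta> (\<gamma> x) \<le> s i"
        unfolding s_def using A1[of x] M \<alpha>1[of i] \<epsilon>
        by (intro mult_mono mult_left_mono Ax \<eta>x \<eta>0 qx(1)) auto
      then have "ennreal \<bar>q x\<bar> \<le> ennreal (s i)" using qx(2) by (intro ennreal_leI) linarith
      moreover have "x \<in> J i"
        using x bX[of i] by (auto simp: J_def intro: cSup_upper cInf_lower)
      ultimately have "ennreal \<bar>q x\<bar> * indicator {-B..B} x \<le> ennreal (s i) * indicator (J i) x"
        using True by simp
      also have "\<dots> \<le> (\<Sum>i. ennreal (s i) * indicator (J i) x)"
        using sum_le_suminf[OF summableI, of "{i}" "\<lambda>i. ennreal (s i) * indicator (J i) x"]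
        by (simp del: sum_mult_indicator)
      finally show ?thesis .
    qed (auto simp: indicator_def)
    have len: "ennreal (s i) * emeasure lborel (J i)
        \<le> ennreal (M * (1 + \<epsilon>)\<^sup>2 * (\<eta> (c i) + \<epsilon>)) * ennreal (diameter (C i))" for i
    proof (cases "X i = {}")
      case False
      define k where "k = (1 + \<epsilon>) * diameter (C i) / \<alpha> i"
      have k0: "0 \<le> k" using diameter_ge_0[OF bC[of i]] \<epsilon> \<alpha>1[of i] by (simp add: k_def)
      have diff: "x - y \<le> k" if xy: "x \<in> X i" "y \<in> X i" for x y
      proof -
        obtain \<xi> where \<xi>: "min x y \<le> \<xi>" "\<xi> \<le> max x y" "dist (\<gamma> x) (\<gamma> y) = \<bar>x - y\<bar> * A \<xi>"
          using chord by blast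
        define z where "z = (SOME x. x \<in> X i)"
        have z: "z \<in> X i" unfolding z_def by (rule pick[OF xy(1)])
        have "\<xi> \<in> {-B..B}" using \<xi>(1,2) XB[OF xy(1)] XB[OF xy(2)] by auto
        moreover have "\<bar>z - \<xi>\<bar> \<le> \<delta>"
          using close[OF z xy(1)] close[OF z xy(2)] \<xi>(1,2) by (auto simp: abs_le_iff min_def max_def split: if_splits)
        ultimately have "\<alpha> i \<le> (1 + \<epsilon>) * A \<xi>"
          unfolding \<alpha>_def z_def[symmetric] using XB[OF z] by (intro A\<epsilon>)
        then have "\<bar>x - y\<bar> * \<alpha> i \<le> \<bar>x - y\<bar> * ((1 + \<epsilon>) * A \<xi>)" by (intro mult_left_mono) auto
        also have "\<dots> = (1 + \<epsilon>) * dist (\<gamma> x) (\<gamma> y)" by (simp add: \<xi>(3))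
        also have "\<dots> \<le> (1 + \<epsilon>) * diameter (C i)"
          using dist\<gamma>[OF xy] \<epsilon> by (intro mult_left_mono) auto
        finally have "\<bar>x - y\<bar> \<le> k" using \<alpha>1[of i] by (simp add: k_def field_simps)
        then show ?thesis by linarith
      qed
      have "Sup (X i) \<le> Inf (X i) + k"
      proof (rule cSup_least[OF False])
        fix x assume x: "x \<in> X i"
        have "x - k \<le> Inf (X i)"
          by (rule cInf_greatest[OF False]) (use diff[OF x] in \<open>auto simp: algebra_simps\<close>)
        then show "x \<le> Inf (X i) + k" by simp
      qed
      moreover have "Inf (X i) \<le> Sup (X i)"
        using False bX[of i] by (intro cInf_le_cSup) auto
      ultimately have "emeasure lborel (J i) \<le> ennreal k"
        using False by (simp add: J_def ennreal_leI)
      then have "ennreal (s i) * emeasure lborel (J i) \<le> ennreal (s i) * ennreal k"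
        by (intro mult_left_mono) auto
      also have "\<dots> = ennreal (s i * k)" using s0 k0 by (simp add: ennreal_mult)
      also have "s i * k = (M * (1 + \<epsilon>)\<^sup>2 * (\<eta> (c i) + \<epsilon>)) * diameter (C i)"
        using \<alpha>1[of i] by (simp add: s_def k_def power2_eq_square)
      also have "ennreal \<dots> = ennreal (M * (1 + \<epsilon>)\<^sup>2 * (\<eta> (c i) + \<epsilon>)) * ennreal (diameter (C i))"
        using M \<epsilon> \<eta>0[OF cS[of i]] by (intro ennreal_mult) (auto simp: diameter_ge_0[OF bC])
      finally show ?thesis .
    qed (simp add: J_def)
    have "integral {-B..B} q = (LINT x:{-B..B}|lborel. q x)"
      using borel_integrable_atLeastAtMost'[OF cq] by (simp add: set_borel_integral_eq_integral(2))
    also have "ennreal \<bar>\<dots>\<bar> \<le> (\<integral>\<^sup>+x. ennreal \<bar>q x\<bar> * indicator {-B..B} x \<partial>lborel)"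
    proof -
      have "integrable lborel (\<lambda>x. indicator {-B..B} x *\<^sub>R q x)"
        using borel_integrable_atLeastAtMost'[OF cq] by (simp add: set_integrable_def)
      from integral_norm_bound_ennreal[OF this] show ?thesis
        unfolding set_lebesgue_integral_def
        by (simp add: abs_mult ennreal_mult' ennreal_indicator mult.commute)
    qed
    also have "\<dots> \<le> (\<integral>\<^sup>+x. (\<Sum>i. ennreal (s i) * indicator (J i) x) \<partial>lborel)"
      by (intro nn_integral_mono pt)
    also have "\<dots> = (\<Sum>i. \<integral>\<^sup>+x. ennreal (s i) * indicator (J i) x \<partial>lborel)"
      by (intro nn_integral_suminf) (auto simp: J_def)
    also have "\<dots> = (\<Sum>i. ennreal (s i) * emeasure lborel (J i))"
      by (intro suminf_cong nn_integral_cmult_indicator) (auto simp: J_def)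
    also have "\<dots> \<le> (\<Sum>i. ennreal (M * (1 + \<epsilon>)\<^sup>2 * (\<eta> (c i) + \<epsilon>)) * ennreal (diameter (C i)))"
      by (intro suminf_le len) auto
    finally show "ennreal \<bar>integral {-B..B} q\<bar>
        \<le> (\<Sum>i. ennreal (M * (1 + \<epsilon>)\<^sup>2 * (\<eta> (c i) + \<epsilon>)) * ennreal (diameter (C i)))" .
  qed
qed

lemma hausdorff1_approx_finite_cover:
  assumes "finite \<C>" "S \<subseteq> \<Union>\<C>" "\<And>C. C \<in> \<C> \<Longrightarrow> bounded C" "\<And>C. C \<in> \<C> \<Longrightarrow> diameter C \<le> \<delta>" "0 \<le> \<delta>"
  shows "hausdorff1_approx \<delta> S \<le> (\<Sum>C\<in>\<C>. ennreal (diameter C))"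
proof -
  obtain h n where h: "\<C> = h ` {i::nat. i < n}" "inj_on h {i. i < n}"
    using finite_imp_nat_seg_image_inj_on[OF assms(1)] by blast
  define D where "D i = (if i < n then h i else {})" for i
  have "S \<subseteq> (\<Union>i. D i)"
  proof
    fix x assume "x \<in> S"
    then obtain i where "i < n" "x \<in> h i" using assms(2) h(1) by auto
    then show "x \<in> (\<Union>i. D i)" by (auto simp: D_def)
  qed
  moreover have "bounded (D i) \<and> diameter (D i) \<le> \<delta>" for i
    using assms(3-5) h(1) by (auto simp: D_def)
  ultimately have "hausdorff1_approx \<delta> S \<le> (\<Sum>i. ennreal (diameter (D i)))"
    unfolding hausdorff1_approx_def by (intro Inf_lower) auto
  also have "\<dots> = (\<Sum>i<n. ennreal (diameter (D i)))"
    by (rule suminf_finite) (auto simp: D_def)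
  also have "\<dots> = (\<Sum>i<n. ennreal (diameter (h i)))" by (simp add: D_def)
  also have "\<dots> = (\<Sum>C\<in>\<C>. ennreal (diameter C))"
    using h by (simp add: sum.reindex lessThan_def)
  finally show ?thesis .
qed

text \<open>
Cutting each parameter interval into \<open>N\<close> equal parts produces pieces of diameter at most \<open>L i / N\<close>,
whose diameters add up to a bound that does not depend on \<open>N\<close>.
\<close>
lemma hausdorff1_lipschitz_curves:
  fixes f :: "'i \<Rightarrow> real \<Rightarrow> 'a::real_normed_vector"
  assumes I: "finite I" and S: "S \<subseteq> (\<Union>i\<in>I. f i ` {0..1})"
    and lip: "\<And>i s t. i \<in> I \<Longrightarrow> s \<in> {0..1} \<Longrightarrow> t \<in> {0..1} \<Longrightarrow> dist (f i s) (f i t) \<le> L i * \<bar>s - t\<bar>"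
    and L: "\<And>i. i \<in> I \<Longrightarrow> 0 \<le> L i"
  shows "hausdorff1 S \<le> ennreal (\<Sum>i\<in>I. L i)"
  unfolding hausdorff1_def
proof (rule SUP_least)
  fix \<delta> :: real assume "\<delta> \<in> {0<..}"
  then have \<delta>: "0 < \<delta>" by simp
  obtain N0 where "max 1 ((\<Sum>i\<in>I. L i) / \<delta>) < real N0"
    using reals_Archimedean2 by blast
  then obtain N where N: "0 < N" "(\<Sum>i\<in>I. L i) / \<delta> < real N"
    by (intro that[of N0]) auto
  have LN: "L i / real N \<le> \<delta>" if "i \<in> I" for i
  proof -
    have "L i \<le> (\<Sum>i\<in>I. L i)" using that L by (intro member_le_sum I) auto
    also have "\<dots> \<le> \<delta> * real N" using N(2) \<delta> by (simp add: field_simps)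
    finally show ?thesis using N(1) by (simp add: field_simps)
  qed
  define p where "p = (\<lambda>(i, k). f i ` {real k / real N..real (Suc k) / real N})"
  have pL: "dist x y \<le> L i / real N" if ik: "i \<in> I" "k < N" and xy: "x \<in> p (i, k)" "y \<in> p (i, k)" for i k x y
  proof -
    obtain s t where st: "s \<in> {real k / real N..real (Suc k) / real N}" "t \<in> {real k / real N..real (Suc k) / real N}"
      "x = f i s" "y = f i t" using xy by (auto simp: p_def)
    have "{real k / real N..real (Suc k) / real N} \<subseteq> {0..1}" using ik(2) by (auto simp: field_simps)
    then have "dist x y \<le> L i * \<bar>s - t\<bar>" using st ik(1) lip by blast
    also have "\<bar>s - t\<bar> \<le> 1 / real N" using st(1,2) by (auto simp: add_divide_distrib abs_le_iff)
    then have "L i * \<bar>s - t\<bar> \<le> L i * (1 / real N)" using L[OF ik(1)] by (rule mult_left_mono)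
    finally show ?thesis by simp
  qed
  have b: "bounded (p (i, k))" and d: "diameter (p (i, k)) \<le> L i / real N" if ik: "i \<in> I" "k < N" for i k
  proof -
    show "bounded (p (i, k))" unfolding bounded_two_points using pL[OF ik] by blast
    show "diameter (p (i, k)) \<le> L i / real N"
      using pL[OF ik] L[OF ik(1)] by (intro diameter_le) (auto simp: dist_norm)
  qed
  have "hausdorff1_approx \<delta> S \<le> (\<Sum>C\<in>p ` (I \<times> {..<N}). ennreal (diameter C))"
  proof (rule hausdorff1_approx_finite_cover)
    show "S \<subseteq> \<Union> (p ` (I \<times> {..<N}))"
    proof
      fix x assume "x \<in> S"
      then obtain i where i: "i \<in> I" "x \<in> f i ` {0..1}" using S by blast
      then obtain t where t: "0 \<le> t" "t \<le> 1" "x = f i t" by auto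
      have "\<exists>k<N. real k / real N \<le> t \<and> t \<le> real (Suc k) / real N"
      proof (cases "t = 1")
        case True
        then show ?thesis using N(1) by (intro exI[of _ "N - 1"]) (auto simp: field_simps)
      next
        case False
        define k where "k = nat \<lfloor>t * real N\<rfloor>"
        have "t * real N < real N" using t False N(1) by simp
        then have "real k \<le> t * real N" "t * real N < real k + 1" using t(1) by (auto simp: k_def)
        moreover from this have "k < N" using \<open>t * real N < real N\<close> by linarith
        ultimately show ?thesis using N(1)
          by (intro exI[of _ k]) (auto simp: field_simps)
      qed
      then show "x \<in> \<Union> (p ` (I \<times> {..<N}))" using i(1) t by (fastforce simp: p_def)
    qed
    show "diameter C \<le> \<delta>" if "C \<in> p ` (I \<times> {..<N})" for C
      using that d LN by (auto intro: order_trans)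
  qed (use I b \<delta> in auto)
  also have "\<dots> \<le> (\<Sum>ik\<in>I \<times> {..<N}. ennreal (diameter (p ik)))"
    using I sum_image_le[of "I \<times> {..<N}" "\<lambda>C. ennreal (diameter C)" p] by (simp add: o_def)
  also have "\<dots> \<le> (\<Sum>ik\<in>I \<times> {..<N}. ennreal (L (fst ik) / real N))"
    using d by (intro sum_mono ennreal_leI) auto
  also have "\<dots> = ennreal (\<Sum>ik\<in>I \<times> {..<N}. L (fst ik) / real N)"
    using L by (intro sum_ennreal) auto
  also have "(\<Sum>ik\<in>I \<times> {..<N}. L (fst ik) / real N) = (\<Sum>(i, k)\<in>I \<times> {..<N}. L i / real N)"
    by (simp add: split_def)
  also have "\<dots> = (\<Sum>i\<in>I. \<Sum>k<N. L i / real N)"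
    by (rule sum.cartesian_product[symmetric])
  also have "\<dots> = (\<Sum>i\<in>I. L i)" using N(1) by simp
  finally show "hausdorff1_approx \<delta> S \<le> ennreal (\<Sum>i\<in>I. L i)" .
qed

section \<open>Graph patches and partitions of unity\<close>

lemma has_real_derivative_max_sq: "((\<lambda>x::real. (max 0 x)\<^sup>2) has_real_derivative 2 * max 0 x) (at x)"
proof (cases "x = 0")
  case True
  have "((\<lambda>h::real. (max 0 h)\<^sup>2 / h) \<longlongrightarrow> 0) (at 0)"
  proof (rule Lim_null_comparison[where g=abs])
    show "\<forall>\<^sub>F h in at 0. norm ((max 0 h)\<^sup>2 / h) \<le> \<bar>h\<bar>"
      by (intro always_eventually) (auto simp: max_def power2_eq_square)
    show "(abs \<longlongrightarrow> (0::real)) (at 0)" by (auto intro!: tendsto_eq_intros)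
  qed
  then show ?thesis by (simp add: True DERIV_def)
next
  case False
  then consider "0 < x" | "x < 0" by linarith
  then show ?thesis
  proof cases
    case 1
    have "((\<lambda>x::real. x\<^sup>2) has_real_derivative 2 * max 0 x) (at x)"
      using 1 by (auto intro!: derivative_eq_intros)
    then show ?thesis
      by (rule has_field_derivative_transform_within_open[where S="{0<..}"]) (use 1 in auto)
  next
    case 2
    have "((\<lambda>x::real. 0) has_real_derivative 2 * max 0 x) (at x)" using 2 by simp
    then show ?thesis
      by (rule has_field_derivative_transform_within_open[where S="{..<0}"]) (use 2 in auto)
  qed
qed

text \<open>
The bumps \<open>(max 0 (\<rho>\<^sup>2 - |w - a|\<^sup>2))\<^sup>2\<close> are continuously differentiable because squaring removes the
corner of \<open>max\<close>; dividing them by their sum, which is positive on \<open>K\<close>, gives the partition.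
\<close>
lemma C1_partition_of_unity:
  fixes K :: "'a::real_inner set" and \<rho> :: "'a \<Rightarrow> real"
  assumes K: "compact K" and \<rho>: "\<And>a. a \<in> K \<Longrightarrow> 0 < \<rho> a"
  obtains A \<eta> \<eta>' where "finite A" "A \<subseteq> K"
    and "\<And>a w. a \<in> A \<Longrightarrow> w \<in> K \<Longrightarrow> 0 \<le> \<eta> a w"
    and "\<And>w. w \<in> K \<Longrightarrow> (\<Sum>a\<in>A. \<eta> a w) = (1::real)"
    and "\<And>a w. a \<in> A \<Longrightarrow> \<rho> a \<le> dist a w \<Longrightarrow> \<eta> a w = 0"
    and "\<And>a w. a \<in> A \<Longrightarrow> w \<in> K \<Longrightarrow> (\<eta> a has_derivative \<eta>' a w) (at w)"
    and "\<And>a h. a \<in> A \<Longrightarrow> continuous_on K (\<lambda>w. \<eta>' a w h)"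
proof -
  have "K \<subseteq> (\<Union>a\<in>K. ball a (\<rho> a))" using \<rho> by auto
  then obtain A where A: "A \<subseteq> K" "finite A" "K \<subseteq> (\<Union>a\<in>A. ball a (\<rho> a))"
    using compactE_image[OF K, of K "\<lambda>a. ball a (\<rho> a)"] by auto
  define d where "d a w = max 0 ((\<rho> a)\<^sup>2 - (w - a) \<bullet> (w - a))" for a w
  define \<beta> where "\<beta> a w = (d a w)\<^sup>2" for a w
  define \<beta>' where "\<beta>' a w h = 2 * d a w * (- (2 * ((w - a) \<bullet> h)))" for a w h
  define T where "T w = (\<Sum>a\<in>A. \<beta> a w)" for w
  define T' where "T' w h = (\<Sum>a\<in>A. \<beta>' a w h)" for w h
  have d\<beta>: "(\<beta> a has_derivative \<beta>' a w) (at w)" for a w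
  proof -
    have "((\<lambda>w. (\<rho> a)\<^sup>2 - (w - a) \<bullet> (w - a)) has_derivative (\<lambda>h. - (2 * ((w - a) \<bullet> h)))) (at w)"
      by (auto intro!: derivative_eq_intros simp: inner_commute)
    from has_derivative_compose[OF this has_real_derivative_max_sq[unfolded has_field_derivative_def]]
    show ?thesis unfolding \<beta>_def \<beta>'_def d_def .
  qed
  have dT: "(T has_derivative T' w) (at w)" for w
    unfolding T_def T'_def by (intro has_derivative_sum d\<beta>)
  have c\<beta>: "continuous_on X (\<beta> a)" and c\<beta>': "continuous_on X (\<lambda>w. \<beta>' a w h)" for X a h
    unfolding \<beta>_def \<beta>'_def d_def by (intro continuous_intros)+
  have cT: "continuous_on X T" and cT': "continuous_on X (\<lambda>w. T' w h)" for X h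
    unfolding T_def T'_def by (intro continuous_intros c\<beta> c\<beta>')+
  have \<beta>0: "0 \<le> \<beta> a w" for a w by (simp add: \<beta>_def)
  have Tpos: "0 < T w" if w: "w \<in> K" for w
  proof -
    obtain a where a: "a \<in> A" "dist a w < \<rho> a" using A(3) w by auto
    have "(w - a) \<bullet> (w - a) = (dist a w)\<^sup>2"
      by (metis dist_commute dist_norm power2_norm_eq_inner)
    also have "\<dots> < (\<rho> a)\<^sup>2" using a(2) by (intro power_strict_mono) auto
    finally have "0 < \<beta> a w" by (simp add: \<beta>_def d_def)
    also have "\<beta> a w \<le> T w" unfolding T_def using a(1) A(2) \<beta>0 by (intro member_le_sum) auto
    finally show ?thesis .
  qed
  define \<eta> where "\<eta> a w = \<beta> a w / T w" for a w
  define \<eta>' where "\<eta>' a w h = (\<beta>' a w h * T w - \<beta> a w * T' w h) / (T w * T w)" for a w h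
  show thesis
  proof (rule that[of A \<eta> \<eta>'])
    show "0 \<le> \<eta> a w" if "w \<in> K" for a w using Tpos[OF that] \<beta>0 by (simp add: \<eta>_def)
    show "(\<Sum>a\<in>A. \<eta> a w) = 1" if "w \<in> K" for w
      using Tpos[OF that] by (simp add: \<eta>_def T_def flip: sum_divide_distrib)
    show "\<eta> a w = 0" if "a \<in> A" "\<rho> a \<le> dist a w" for a w
    proof -
      have "(\<rho> a)\<^sup>2 \<le> (dist a w)\<^sup>2" using that \<rho> A(1) by (intro power_mono) (auto intro: less_imp_le)
      also have "\<dots> = (w - a) \<bullet> (w - a)"
        by (metis dist_commute dist_norm power2_norm_eq_inner)
      finally show ?thesis by (simp add: \<eta>_def \<beta>_def d_def)
    qed
    show "(\<eta> a has_derivative \<eta>' a w) (at w)" if "w \<in> K" for a w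
      using has_derivative_divide'[OF d\<beta> dT] Tpos[OF that] unfolding \<eta>_def \<eta>'_def by simp
    show "continuous_on K (\<lambda>w. \<eta>' a w h)" for a h
      unfolding \<eta>'_def by (intro continuous_intros c\<beta> c\<beta>' cT cT') (use Tpos in force)
  qed (use A in auto)
qed

text \<open>
The functions \<open>g\<close> and \<open>g'\<close> describe the boundary near \<open>a\<close>. Points in the interior have such a patch as
well, whose graph passes below the ball, so that one argument covers both kinds of points.
\<close>
definition graph_patch ::
  "(real \<times> real) set \<Rightarrow> real \<times> real \<Rightarrow> real \<times> real \<Rightarrow> real \<times> real \<Rightarrow> real \<Rightarrow>
    (real \<Rightarrow> real) \<Rightarrow> (real \<Rightarrow> real) \<Rightarrow> bool" where
  "graph_patch \<Omega> a u v r g g' \<longleftrightarrow> norm u = 1 \<and> norm v = 1 \<and> u \<bullet> v = 0 \<and> 0 < r \<and>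
     (\<forall>x::real. (g has_real_derivative g' x) (at x)) \<and> continuous_on UNIV g' \<and>
     \<Omega> \<inter> ball a r = {w \<in> ball a r. g (w \<bullet> u) < w \<bullet> v}"

lemma C1_regular_boundary_graph_patch:
  assumes op: "open \<Omega>" and reg: "C1_regular_boundary \<Omega>" and a: "a \<in> closure \<Omega>"
  shows "\<exists>u v r g g'. graph_patch \<Omega> a u v r g g'"
proof (cases "a \<in> \<Omega>")
  case True
  then obtain r where r: "0 < r" "ball a r \<subseteq> \<Omega>" using op openE by blast
  have "snd a - r < snd w" if "w \<in> ball a r" for w
    using dist_snd_le[of a w] that by (auto simp: dist_real_def)
  then have "\<Omega> \<inter> ball a r = {w \<in> ball a r. (\<lambda>x. snd a - r) (w \<bullet> (1, 0)) < w \<bullet> (0, 1)}"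
    using r(2) by (auto simp: inner_prod_def)
  then have "graph_patch \<Omega> a (1, 0) (0, 1) r (\<lambda>x. snd a - r) (\<lambda>x. 0)"
    using r(1) by (simp add: graph_patch_def norm_Pair)
  then show ?thesis by blast
next
  case False
  then have "a \<in> frontier \<Omega>" using a op by (simp add: frontier_def interior_open)
  then obtain u v r g where p: "norm u = 1" "norm v = 1" "u \<bullet> v = 0" "r > 0"
    "(g :: real \<Rightarrow> real) C1_differentiable_on UNIV" "\<Omega> \<inter> ball a r = {w \<in> ball a r. g (w \<bullet> u) < w \<bullet> v}"
    using reg unfolding C1_regular_boundary_def by blast
  from p(5) obtain g' where "\<forall>x. (g has_vector_derivative g' x) (at x)" "continuous_on UNIV g'"
    unfolding C1_differentiable_on_def by auto
  with p have "graph_patch \<Omega> a u v r g g'"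
    by (simp add: graph_patch_def has_real_derivative_iff_has_vector_derivative)
  then show ?thesis by blast
qed

lemma graph_patch_continuous: "graph_patch \<Omega> a u v r g g' \<Longrightarrow> continuous_on UNIV g"
  by (meson DERIV_continuous continuous_at_imp_continuous_on graph_patch_def)

lemma graph_patch_lipschitz_curve:
  fixes \<Omega> :: "(real \<times> real) set"
  assumes op: "open \<Omega>" and p: "graph_patch \<Omega> a u v r g g'"
  shows "\<exists>f L. 0 \<le> L \<and> frontier \<Omega> \<inter> ball a r \<subseteq> f ` {0..1::real} \<and>
    (\<forall>s\<in>{0..1}. \<forall>t\<in>{0..1}. dist (f s) (f t) \<le> L * \<bar>s - t\<bar>)"
proof -
  have p': "norm u = 1" "norm v = 1" "u \<bullet> v = 0" "0 < r" "\<And>x. (g has_real_derivative g' x) (at x)"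
    "continuous_on UNIV g'" "\<Omega> \<inter> ball a r = {w \<in> ball a r. g (w \<bullet> u) < w \<bullet> v}"
    using p by (auto simp: graph_patch_def)
  define B where "B = norm a + r"
  have B: "0 < B" using p'(4) by (simp add: B_def add_nonneg_pos)
  have "compact ((\<lambda>x. sqrt (1 + (g' x)\<^sup>2)) ` {-B..B})"
    by (intro compact_continuous_image continuous_intros continuous_on_subset[OF p'(6)]) auto
  then obtain H where H: "\<And>x. x \<in> {-B..B} \<Longrightarrow> sqrt (1 + (g' x)\<^sup>2) \<le> H"
    by (meson bounded_imp_bdd_above bdd_above.unfold compact_imp_bounded imageI)
  have "0 \<le> sqrt (1 + (g' 0)\<^sup>2)" by simp
  also have "\<dots> \<le> H" using B by (intro H) auto
  finally have H0: "0 \<le> H" .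
  define \<gamma> where "\<gamma> x = x *\<^sub>R u + g x *\<^sub>R v" for x
  define f where "f t = \<gamma> (2 * B * t - B)" for t
  have "dist (f s) (f t) \<le> 2 * B * H * \<bar>s - t\<bar>" if st: "s \<in> {0..1}" "t \<in> {0..1}" for s t
  proof -
    define x y where xy: "x = 2 * B * s - B" "y = 2 * B * t - B"
    have "0 \<le> B * s" "B * s \<le> B * 1" "0 \<le> B * t" "B * t \<le> B * 1"
      using st B by (auto intro!: mult_left_mono)
    then have xyB: "x \<in> {-B..B}" "y \<in> {-B..B}" by (auto simp: xy)
    obtain \<xi> where \<xi>: "min x y \<le> \<xi>" "\<xi> \<le> max x y" "dist (\<gamma> x) (\<gamma> y) = \<bar>x - y\<bar> * sqrt (1 + (g' \<xi>)\<^sup>2)"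
      using graph_chord[OF p'(1-3,5), of x y] unfolding \<gamma>_def by metis
    have "dist (f s) (f t) = \<bar>x - y\<bar> * sqrt (1 + (g' \<xi>)\<^sup>2)" using \<xi>(3) by (simp add: f_def xy)
    also have "\<dots> \<le> \<bar>x - y\<bar> * H"
      using \<xi>(1,2) xyB by (intro mult_left_mono H) auto
    also have "x - y = 2 * B * (s - t)" by (simp add: xy algebra_simps)
    also have "\<bar>\<dots>\<bar> * H = 2 * B * H * \<bar>s - t\<bar>" using B by (simp add: abs_mult)
    finally show ?thesis .
  qed
  moreover have "frontier \<Omega> \<inter> ball a r \<subseteq> f ` {0..1}"
  proof
    fix w assume w: "w \<in> frontier \<Omega> \<inter> ball a r"
    then have "w \<bullet> v = g (w \<bullet> u)"
      using graph_patch_frontier[OF op p'(3,2) graph_patch_continuous[OF p] p'(7)] by blast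
    then have w\<gamma>: "w = \<gamma> (w \<bullet> u)"
      using orthonormal_expansion[OF p'(1-3), of w] by (simp add: \<gamma>_def)
    have "\<bar>w \<bullet> u\<bar> \<le> norm w * norm u" by (rule Cauchy_Schwarz_ineq2)
    also have "\<dots> \<le> B" using w norm_triangle_ineq2[of w a] p'(1)
      by (simp add: B_def dist_norm norm_minus_commute)
    finally have wB: "\<bar>w \<bullet> u\<bar> \<le> B" .
    have "w = f ((w \<bullet> u + B) / (2 * B))" using w\<gamma> B by (simp add: f_def)
    moreover have "(w \<bullet> u + B) / (2 * B) \<in> {0..1}" using wB B by (auto simp: field_simps abs_le_iff)
    ultimately show "w \<in> f ` {0..1}" by blast
  qed
  ultimately show ?thesis
    using B H0 by (intro exI[of _ f] exI[of _ "2 * B * H"]) auto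
qed

text \<open>
The real number \<open>curve_length\<close> is zero by convention when the Hausdorff measure is infinite, so an
upper bound by the length is meaningful only because of this lemma.
\<close>
lemma hausdorff1_frontier_finite:
  assumes op: "open \<Omega>" and bd: "bounded \<Omega>" and reg: "C1_regular_boundary \<Omega>"
  shows "hausdorff1 (frontier \<Omega>) < \<infinity>"
proof -
  have "\<exists>r f L. 0 < r \<and> 0 \<le> L \<and> frontier \<Omega> \<inter> ball a r \<subseteq> f ` {0..1::real} \<and>
    (\<forall>s\<in>{0..1}. \<forall>t\<in>{0..1}. dist (f s) (f t) \<le> L * \<bar>s - t\<bar>)" if a: "a \<in> frontier \<Omega>" for a
  proof -
    have "a \<in> closure \<Omega>" using a by (simp add: frontier_def)
    then obtain u v r g g' where p: "graph_patch \<Omega> a u v r g g'"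
      using C1_regular_boundary_graph_patch[OF op reg] by blast
    moreover have "0 < r" using p by (simp add: graph_patch_def)
    ultimately show ?thesis using graph_patch_lipschitz_curve[OF op p] by blast
  qed
  then obtain r f L where P: "\<And>a. a \<in> frontier \<Omega> \<Longrightarrow> 0 < r a \<and> 0 \<le> L a \<and>
    frontier \<Omega> \<inter> ball a (r a) \<subseteq> f a ` {0..1::real} \<and>
    (\<forall>s\<in>{0..1}. \<forall>t\<in>{0..1}. dist (f a s) (f a t) \<le> L a * \<bar>s - t\<bar>)"
    by metis
  have "compact (frontier \<Omega>)" using bd by (rule compact_frontier_bounded)
  moreover have "frontier \<Omega> \<subseteq> (\<Union>a\<in>frontier \<Omega>. ball a (r a))" using P by force
  ultimately obtain A where A: "A \<subseteq> frontier \<Omega>" "finite A" "frontier \<Omega> \<subseteq> (\<Union>a\<in>A. ball a (r a))"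
    using compactE_image[of "frontier \<Omega>" "frontier \<Omega>" "\<lambda>a. ball a (r a)"] by auto
  have "frontier \<Omega> \<subseteq> (\<Union>a\<in>A. f a ` {0..1})"
  proof
    fix w assume w: "w \<in> frontier \<Omega>"
    then obtain a where "a \<in> A" "w \<in> ball a (r a)" using A(3) by blast
    then show "w \<in> (\<Union>a\<in>A. f a ` {0..1})" using P[of a] A(1) w by blast
  qed
  then have "hausdorff1 (frontier \<Omega>) \<le> ennreal (\<Sum>a\<in>A. L a)"
    by (rule hausdorff1_lipschitz_curves[OF A(2)]) (use A(1) P in blast)+
  then show ?thesis by (simp add: le_less_trans)
qed

lemma set_integrable_continuous_bounded:
  fixes f :: "'a::euclidean_space \<Rightarrow> real"
  assumes "open \<Omega>" "bounded \<Omega>" "continuous_on \<Omega> f" "\<And>w. w \<in> \<Omega> \<Longrightarrow> \<bar>f w\<bar> \<le> K"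
  shows "set_integrable lborel \<Omega> f"
  unfolding set_integrable_def
proof (rule integrableI_bounded_set[where A=\<Omega> and B=K])
  show "(\<lambda>x. indicator \<Omega> x *\<^sub>R f x) \<in> borel_measurable lborel"
    using borel_measurable_continuous_on_indicator[OF _ assms(3)] assms(1) by simp
  show "emeasure lborel \<Omega> < \<infinity>" by (rule emeasure_bounded_finite[OF assms(2)])
qed (use assms in auto)

section \<open>The divergence integral is bounded by the boundary length\<close>

text \<open>
The field is split as \<open>\<Sum>a. \<eta> a W\<close> by a partition of unity subordinate to the patches. Each summand
contributes a boundary integral over its graph, which is at most \<open>M (1 + \<epsilon>)\<^sup>2 \<Sum>i. (\<eta> a (c i) + \<epsilon>) d i\<close>
for every covering of the boundary by sets of small diameters \<open>d i\<close>. Summing over \<open>a\<close> the weights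
\<open>\<eta> a (c i)\<close> add up to one, and \<open>\<Sum>i. d i\<close> comes arbitrarily close to the length, so that the sharp
constant results when \<open>\<epsilon>\<close> tends to zero.
\<close>
lemma divergence_le_boundary:
  fixes W :: "real \<times> real \<Rightarrow> real \<times> real"
  assumes op: "open \<Omega>" and bd: "bounded \<Omega>" and ne: "\<Omega> \<noteq> {}" and reg: "C1_regular_boundary \<Omega>"
    and cW: "continuous_on (closure \<Omega>) W"
    and dW: "\<And>w. w \<in> \<Omega> \<Longrightarrow> (W has_derivative W' w) (at w)"
    and cW': "\<And>h. continuous_on \<Omega> (\<lambda>w. W' w h)"
    and K: "\<And>w. w \<in> \<Omega> \<Longrightarrow> \<bar>trace2 (W' w)\<bar> \<le> K"
    and M: "\<And>w. w \<in> frontier \<Omega> \<Longrightarrow> norm (W w) \<le> M"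
  shows "\<bar>LINT w:\<Omega>|lborel. trace2 (W' w)\<bar> \<le> M * curve_length (frontier \<Omega>)"
proof -
  have cpt: "compact (closure \<Omega>)" using bd by (simp add: compact_closure)
  have cptF: "compact (frontier \<Omega>)" using bd by (rule compact_frontier_bounded)
  have Fcl: "frontier \<Omega> \<subseteq> closure \<Omega>" by (simp add: frontier_def)
  have Fne: "frontier \<Omega> \<noteq> {}" using bd ne by (simp add: frontier_eq_empty) (use not_bounded_UNIV in blast)
  then obtain s0 where s0: "s0 \<in> frontier \<Omega>" by blast
  then have M0: "0 \<le> M" using M norm_ge_zero order_trans by blast
  have "\<forall>a\<in>closure \<Omega>. \<exists>u v r g g'. graph_patch \<Omega> a u v r g g'"
    using C1_regular_boundary_graph_patch[OF op reg] by blast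
  then obtain u v r g g' where p: "\<And>a. a \<in> closure \<Omega> \<Longrightarrow> graph_patch \<Omega> a (u a) (v a) (r a) (g a) (g' a)"
    by metis
  then have p': "norm (u a) = 1" "norm (v a) = 1" "u a \<bullet> v a = 0" "0 < r a"
    "\<And>x. (g a has_real_derivative g' a x) (at x)" "continuous_on UNIV (g' a)"
    "\<Omega> \<inter> ball a (r a) = {w \<in> ball a (r a). g a (w \<bullet> u a) < w \<bullet> v a}" if "a \<in> closure \<Omega>" for a
    using that by (auto simp: graph_patch_def)
  have r2: "0 < r a / 2" if "a \<in> closure \<Omega>" for a using p'(4)[OF that] by simp
  obtain A \<eta> \<eta>' where A: "finite A" "A \<subseteq> closure \<Omega>"
    and \<eta>0: "\<And>a w. a \<in> A \<Longrightarrow> w \<in> closure \<Omega> \<Longrightarrow> 0 \<le> \<eta> a w"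
    and \<eta>1: "\<And>w. w \<in> closure \<Omega> \<Longrightarrow> (\<Sum>a\<in>A. \<eta> a w) = (1::real)"
    and \<eta>s: "\<And>a w. a \<in> A \<Longrightarrow> r a / 2 \<le> dist a w \<Longrightarrow> \<eta> a w = 0"
    and d\<eta>: "\<And>a w. a \<in> A \<Longrightarrow> w \<in> closure \<Omega> \<Longrightarrow> (\<eta> a has_derivative \<eta>' a w) (at w)"
    and c\<eta>': "\<And>a h. a \<in> A \<Longrightarrow> continuous_on (closure \<Omega>) (\<lambda>w. \<eta>' a w h)"
    by (rule C1_partition_of_unity[where \<rho>="\<lambda>a. r a / 2", OF cpt r2])
      (assumption, (rule that; assumption))
  have c\<eta>: "continuous_on (closure \<Omega>) (\<eta> a)" if "a \<in> A" for a
    using d\<eta>[OF that] has_derivative_continuous continuous_at_imp_continuous_on by blast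
  define Y where "Y a w = \<eta> a w *\<^sub>R W w" for a w
  define Y' where "Y' a w h = \<eta> a w *\<^sub>R W' w h + \<eta>' a w h *\<^sub>R W w" for a w h
  have cl: "w \<in> closure \<Omega>" if "w \<in> \<Omega>" for w using that closure_subset by blast
  have dY: "(Y a has_derivative Y' a w) (at w)" if "a \<in> A" "w \<in> \<Omega>" for a w
    unfolding Y_def Y'_def using has_derivative_scaleR[OF d\<eta>[OF that(1) cl[OF that(2)]] dW[OF that(2)]] .
  have cY': "continuous_on \<Omega> (\<lambda>w. Y' a w h)" if "a \<in> A" for a h
    unfolding Y'_def
    by (intro continuous_intros cW' continuous_on_subset[OF c\<eta>[OF that] closure_subset]
        continuous_on_subset[OF c\<eta>'[OF that] closure_subset] continuous_on_subset[OF cW closure_subset])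
  have cY: "continuous_on (closure \<Omega>) (Y a)" if "a \<in> A" for a
    unfolding Y_def by (intro continuous_intros c\<eta>[OF that] cW)
  have trY: "trace2 (Y' a w) = \<eta> a w * trace2 (W' w) + (\<eta>' a w (1, 0) * fst (W w) + \<eta>' a w (0, 1) * snd (W w))" for a w
    by (simp add: trace2_def Y'_def algebra_simps)
  have "\<exists>Ka. \<forall>w\<in>\<Omega>. \<bar>trace2 (Y' a w)\<bar> \<le> Ka" if a: "a \<in> A" for a
  proof -
    have "continuous_on (closure \<Omega>) (\<lambda>w. \<eta>' a w (1, 0) * fst (W w) + \<eta>' a w (0, 1) * snd (W w))"
      by (intro continuous_intros cW c\<eta>'[OF a])
    then have "bounded ((\<lambda>w. \<eta>' a w (1, 0) * fst (W w) + \<eta>' a w (0, 1) * snd (W w)) ` closure \<Omega>)"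
      using cpt compact_continuous_image compact_imp_bounded by blast
    then obtain k where k: "\<And>w. w \<in> closure \<Omega> \<Longrightarrow>
        \<bar>\<eta>' a w (1, 0) * fst (W w) + \<eta>' a w (0, 1) * snd (W w)\<bar> \<le> k"
      unfolding bounded_iff by auto
    have "\<bar>trace2 (Y' a w)\<bar> \<le> K + k" if w: "w \<in> \<Omega>" for w
    proof -
      have "\<eta> a w \<le> (\<Sum>a\<in>A. \<eta> a w)" using a A(1) \<eta>0 cl[OF w] by (intro member_le_sum) auto
      then have "\<bar>\<eta> a w\<bar> \<le> 1" using \<eta>0[OF a cl[OF w]] \<eta>1[OF cl[OF w]] by simp
      then have "\<bar>\<eta> a w * trace2 (W' w)\<bar> \<le> 1 * K"
        unfolding abs_mult using K[OF w] by (intro mult_mono) auto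
      then show ?thesis using k[OF cl[OF w]] unfolding trY by linarith
    qed
    then show ?thesis by blast
  qed
  then obtain Ka where Ka: "\<And>a w. a \<in> A \<Longrightarrow> w \<in> \<Omega> \<Longrightarrow> \<bar>trace2 (Y' a w)\<bar> \<le> Ka a" by metis
  have "trace2 (W' w) = (\<Sum>a\<in>A. trace2 (Y' a w))" if w: "w \<in> \<Omega>" for w
  proof -
    have "((\<lambda>w. \<Sum>a\<in>A. Y a w) has_derivative (\<lambda>h. \<Sum>a\<in>A. Y' a w h)) (at w)"
      using dY w by (intro has_derivative_sum) auto
    then have "(W has_derivative (\<lambda>h. \<Sum>a\<in>A. Y' a w h)) (at w)"
      by (rule has_derivative_transform_within_open[OF _ op w])
        (simp add: Y_def \<eta>1 cl flip: scaleR_sum_left)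
    then have "W' w = (\<lambda>h. \<Sum>a\<in>A. Y' a w h)" using dW[OF w] has_derivative_unique by blast
    then show ?thesis by (simp add: trace2_def fst_sum snd_sum sum.distrib)
  qed
  then have "(LINT w:\<Omega>|lborel. trace2 (W' w)) = (LINT w:\<Omega>|lborel. (\<Sum>a\<in>A. trace2 (Y' a w)))"
    using op by (intro set_lebesgue_integral_cong) auto
  also have "\<dots> = (\<Sum>a\<in>A. LINT w:\<Omega>|lborel. trace2 (Y' a w))"
  proof -
    have "set_integrable lborel \<Omega> (\<lambda>w. trace2 (Y' a w))" if a: "a \<in> A" for a
      by (rule set_integrable_continuous_bounded[OF op bd _ Ka[OF a]])
        (unfold trace2_def, intro continuous_intros cY'[OF a])
    then show ?thesis
      unfolding set_lebesgue_integral_def set_integrable_def scaleR_sum_right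
      by (rule Bochner_Integration.integral_sum)
  qed
  finally have split: "(LINT w:\<Omega>|lborel. trace2 (W' w)) = (\<Sum>a\<in>A. LINT w:\<Omega>|lborel. trace2 (Y' a w))" .
  define \<gamma> where "\<gamma> a x = x *\<^sub>R u a + g a x *\<^sub>R v a" for a x
  define q where "q a x = Y a (\<gamma> a x) \<bullet> v a - g' a x * (Y a (\<gamma> a x) \<bullet> u a)" for a x
  have "\<exists>B. (LINT w:\<Omega>|lborel. trace2 (Y' a w)) = - integral {-B..B} (q a) \<and> continuous_on {-B..B} (q a)"
    if a: "a \<in> A" for a
  proof -
    have acl: "a \<in> closure \<Omega>" using a A(2) by blast
    show ?thesis
    proof (rule graph_patch_divergence[where \<Omega>=\<Omega> and u="u a" and v="v a" and g="g a" and g'="g' a"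
          and \<rho>="r a / 2" and r="r a" and a=a and Y="Y a" and Y'="Y' a" and K="Ka a"])
      show "Y a w = 0" if "r a / 2 \<le> dist a w" for w using \<eta>s[OF a that] by (simp add: Y_def)
    qed (use p'[OF acl] op cY[OF a] dY[OF a] cY'[OF a] Ka[OF a] in \<open>auto simp: q_def[abs_def] \<gamma>_def\<close>)
  qed
  then obtain B where B: "\<And>a. a \<in> A \<Longrightarrow> (LINT w:\<Omega>|lborel. trace2 (Y' a w)) = - integral {-B a..B a} (q a)"
    "\<And>a. a \<in> A \<Longrightarrow> continuous_on {-B a..B a} (q a)" by metis
  have total: "\<bar>LINT w:\<Omega>|lborel. trace2 (W' w)\<bar> \<le> (\<Sum>a\<in>A. \<bar>integral {-B a..B a} (q a)\<bar>)"
    unfolding split using B(1) by (intro order_trans[OF sum_abs]) simp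
  have q: "\<gamma> a x \<in> frontier \<Omega> \<and> \<bar>q a x\<bar> \<le> M * sqrt (1 + (g' a x)\<^sup>2) * \<eta> a (\<gamma> a x)"
    if a: "a \<in> A" and nz: "q a x \<noteq> 0" for a x
  proof -
    have acl: "a \<in> closure \<Omega>" using a A(2) by blast
    note pa = p'[OF acl]
    have uu: "u a \<bullet> u a = 1" "v a \<bullet> v a = 1" "v a \<bullet> u a = 0"
      using pa by (auto simp: norm_eq_1 inner_commute)
    have "\<eta> a (\<gamma> a x) \<noteq> 0" using nz by (auto simp: q_def Y_def)
    then have "dist a (\<gamma> a x) < r a / 2" using \<eta>s[OF a, of "\<gamma> a x"] by linarith
    then have "\<gamma> a x \<in> ball a (r a)" using pa(4) by simp
    moreover have "\<gamma> a x \<bullet> v a = g a (\<gamma> a x \<bullet> u a)"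
      using uu pa(3) by (simp add: \<gamma>_def inner_add_left)
    ultimately have F: "\<gamma> a x \<in> frontier \<Omega>"
      using graph_patch_frontier[OF op pa(3,2) graph_patch_continuous[OF p[OF acl]] pa(7)] by blast
    have eF: "0 \<le> \<eta> a (\<gamma> a x)" using \<eta>0[OF a] F Fcl by blast
    have "q a x = Y a (\<gamma> a x) \<bullet> (v a - g' a x *\<^sub>R u a)" by (simp add: q_def inner_diff_right)
    then have "\<bar>q a x\<bar> \<le> norm (Y a (\<gamma> a x)) * norm (v a - g' a x *\<^sub>R u a)"
      by (simp add: Cauchy_Schwarz_ineq2)
    also have "norm (v a - g' a x *\<^sub>R u a) = sqrt (1 + (g' a x)\<^sup>2)"
      using uu pa(3) by (simp add: norm_eq_sqrt_inner inner_diff_left inner_diff_right power2_eq_square)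
    also have "norm (Y a (\<gamma> a x)) = \<eta> a (\<gamma> a x) * norm (W (\<gamma> a x))"
      using eF by (simp add: Y_def)
    also have "\<dots> * sqrt (1 + (g' a x)\<^sup>2) \<le> (\<eta> a (\<gamma> a x) * M) * sqrt (1 + (g' a x)\<^sup>2)"
      using eF M[OF F] by (intro mult_right_mono mult_left_mono) auto
    finally show ?thesis using F by (simp add: mult_ac)
  qed
  define N where "N = real (card A)"
  define H where "H = curve_length (frontier \<Omega>)"
  have H: "hausdorff1 (frontier \<Omega>) = ennreal H" "0 \<le> H"
    using hausdorff1_frontier_finite[OF op bd reg] by (simp_all add: H_def curve_length_def)
  have est: "\<bar>LINT w:\<Omega>|lborel. trace2 (W' w)\<bar> \<le> M * (1 + \<epsilon>)\<^sup>2 * (1 + N * \<epsilon>) * (H + \<epsilon>)" if \<epsilon>: "0 < \<epsilon>" for \<epsilon>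
  proof -
    define tagged_cover where "tagged_cover \<delta> C c \<longleftrightarrow> frontier \<Omega> \<subseteq> (\<Union>i::nat. C i) \<and> (\<forall>i. bounded (C i)) \<and>
      (\<forall>i. diameter (C i) \<le> \<delta>) \<and> (\<forall>i. c i \<in> frontier \<Omega>) \<and>
      (\<forall>i. C i \<inter> frontier \<Omega> \<noteq> {} \<longrightarrow> c i \<in> C i)" for \<delta> C c
    define patch_bound where "patch_bound a C c \<longleftrightarrow> ennreal \<bar>integral {-B a..B a} (q a)\<bar>
      \<le> (\<Sum>i. ennreal (M * (1 + \<epsilon>)\<^sup>2 * (\<eta> a (c i) + \<epsilon>)) * ennreal (diameter (C i)))"
      for a and C :: "nat \<Rightarrow> (real \<times> real) set" and c
    have "\<exists>\<delta>>0. \<forall>C c. tagged_cover \<delta> C c \<longrightarrow> patch_bound a C c" if a: "a \<in> A" for a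
    proof -
      have acl: "a \<in> closure \<Omega>" using a A(2) by blast
      note pa = p'[OF acl]
      have qa: "x *\<^sub>R u a + g a x *\<^sub>R v a \<in> frontier \<Omega> \<and>
          \<bar>q a x\<bar> \<le> M * sqrt (1 + (g' a x)\<^sup>2) * \<eta> a (x *\<^sub>R u a + g a x *\<^sub>R v a)" if "q a x \<noteq> 0" for x
        using q[OF a that] by (simp add: \<gamma>_def)
      have \<eta>F: "0 \<le> \<eta> a w" if "w \<in> frontier \<Omega>" for w using \<eta>0[OF a] that Fcl by blast
      obtain \<delta> where \<delta>: "0 < \<delta>" and est: "\<And>C c. frontier \<Omega> \<subseteq> (\<Union>i::nat. C i) \<Longrightarrow> (\<And>i. bounded (C i)) \<Longrightarrow>
          (\<And>i. diameter (C i) \<le> \<delta>) \<Longrightarrow> (\<And>i. c i \<in> frontier \<Omega>) \<Longrightarrow>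
          (\<And>i. C i \<inter> frontier \<Omega> \<noteq> {} \<Longrightarrow> c i \<in> C i) \<Longrightarrow> patch_bound a C c"
        unfolding patch_bound_def
      proof (rule graph_cover_estimate[OF pa(1-3,5,6) cptF continuous_on_subset[OF c\<eta>[OF a] Fcl] \<eta>F M0 \<epsilon> B(2)[OF a] qa], goal_cases)
        case (3 \<delta>)
        show ?case by (rule 3(1)[OF 3(2)], rule 3(3))
      qed assumption+
      have "patch_bound a C c" if "tagged_cover \<delta> C c" for C c
        by (rule est) (use that in \<open>auto simp: tagged_cover_def\<close>)
      with \<delta> show ?thesis by blast
    qed
    then have "\<forall>a\<in>A. \<exists>\<delta>. 0 < \<delta> \<and> (\<forall>C c. tagged_cover \<delta> C c \<longrightarrow> patch_bound a C c)" by blast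
    from bchoice[OF this] obtain \<delta>a where \<delta>a: "\<And>a. a \<in> A \<Longrightarrow> 0 < \<delta>a a"
      "\<And>a C c. a \<in> A \<Longrightarrow> tagged_cover (\<delta>a a) C c \<Longrightarrow> patch_bound a C c"
      by blast
    define \<delta> where "\<delta> = Min (insert 1 (\<delta>a ` A))"
    have \<delta>: "0 < \<delta>" using A(1) \<delta>a(1) by (auto simp: \<delta>_def)
    have \<delta>le: "\<delta> \<le> \<delta>a a" if "a \<in> A" for a using A(1) that by (auto simp: \<delta>_def)
    have "hausdorff1_approx \<delta> (frontier \<Omega>) \<le> hausdorff1 (frontier \<Omega>)"
      unfolding hausdorff1_def using \<delta> by (intro SUP_upper) auto
    also have "\<dots> < ennreal (H + \<epsilon>)" using H \<epsilon> by (simp add: ennreal_lessI)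
    finally obtain C where C: "frontier \<Omega> \<subseteq> (\<Union>i::nat. C i)" "\<And>i. bounded (C i) \<and> diameter (C i) \<le> \<delta>"
      "(\<Sum>i. ennreal (diameter (C i))) < ennreal (H + \<epsilon>)"
      unfolding hausdorff1_approx_def Inf_less_iff by blast
    \<comment> \<open>Sets that miss the boundary contribute to no patch; their point is arbitrary, but must lie on the boundary for the weights to add up to one.\<close>
    define c where "c i = (if C i \<inter> frontier \<Omega> \<noteq> {} then SOME w. w \<in> C i \<inter> frontier \<Omega> else s0)" for i
    have ci: "c i \<in> C i \<inter> frontier \<Omega>" if "C i \<inter> frontier \<Omega> \<noteq> {}" for i
    proof -
      have "(SOME w. w \<in> C i \<inter> frontier \<Omega>) \<in> C i \<inter> frontier \<Omega>" using that by (intro some_in_eq[THEN iffD2])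
      then show ?thesis using that by (simp add: c_def)
    qed
    have cF: "c i \<in> frontier \<Omega>" for i
      using ci[of i] s0 by (cases "C i \<inter> frontier \<Omega> = {}") (auto simp: c_def)
    let ?k = "M * (1 + \<epsilon>)\<^sup>2"
    have k0: "0 \<le> ?k" using M0 by simp
    have pos: "0 \<le> ?k * (\<eta> a (c i) + \<epsilon>)" if "a \<in> A" for a i
    proof -
      have "0 \<le> \<eta> a (c i)" using \<eta>0[OF that] cF Fcl by blast
      then have "0 \<le> \<eta> a (c i) + \<epsilon>" using \<epsilon> by simp
      with k0 show ?thesis by (rule mult_nonneg_nonneg)
    qed
    have ca: "ennreal \<bar>integral {-B a..B a} (q a)\<bar>
        \<le> (\<Sum>i. ennreal (?k * (\<eta> a (c i) + \<epsilon>)) * ennreal (diameter (C i)))" if a: "a \<in> A" for a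
    proof -
      have "diameter (C i) \<le> \<delta>a a" for i using C(2)[of i] \<delta>le[OF a] by linarith
      then have "tagged_cover (\<delta>a a) C c" using C(1,2) cF ci by (simp add: tagged_cover_def)
      from \<delta>a(2)[OF a this] show ?thesis by (simp add: patch_bound_def)
    qed
    have "ennreal \<bar>LINT w:\<Omega>|lborel. trace2 (W' w)\<bar> \<le> ennreal (\<Sum>a\<in>A. \<bar>integral {-B a..B a} (q a)\<bar>)"
      by (rule ennreal_leI[OF total])
    also have "\<dots> = (\<Sum>a\<in>A. ennreal \<bar>integral {-B a..B a} (q a)\<bar>)" by (simp add: sum_ennreal)
    also have "\<dots> \<le> (\<Sum>a\<in>A. \<Sum>i. ennreal (?k * (\<eta> a (c i) + \<epsilon>)) * ennreal (diameter (C i)))"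
      by (rule sum_mono[OF ca])
    also have "\<dots> = (\<Sum>i. \<Sum>a\<in>A. ennreal (?k * (\<eta> a (c i) + \<epsilon>)) * ennreal (diameter (C i)))"
      by (rule suminf_sum[symmetric]) simp
    also have "\<dots> = (\<Sum>i. ennreal (?k * (1 + N * \<epsilon>)) * ennreal (diameter (C i)))"
    proof (rule suminf_cong)
      fix i
      have "(\<Sum>a\<in>A. ennreal (?k * (\<eta> a (c i) + \<epsilon>))) = ennreal (\<Sum>a\<in>A. ?k * (\<eta> a (c i) + \<epsilon>))"
        using pos by (intro sum_ennreal) auto
      also have "(\<Sum>a\<in>A. ?k * (\<eta> a (c i) + \<epsilon>)) = ?k * ((\<Sum>a\<in>A. \<eta> a (c i)) + N * \<epsilon>)"
        by (simp add: N_def sum.distrib flip: sum_distrib_left)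
      also have "(\<Sum>a\<in>A. \<eta> a (c i)) = 1" using cF[of i] Fcl by (intro \<eta>1) blast
      finally show "(\<Sum>a\<in>A. ennreal (?k * (\<eta> a (c i) + \<epsilon>)) * ennreal (diameter (C i)))
          = ennreal (?k * (1 + N * \<epsilon>)) * ennreal (diameter (C i))"
        by (simp flip: sum_distrib_right)
    qed
    also have "\<dots> = ennreal (?k * (1 + N * \<epsilon>)) * (\<Sum>i. ennreal (diameter (C i)))" by simp
    also have "\<dots> \<le> ennreal (?k * (1 + N * \<epsilon>)) * ennreal (H + \<epsilon>)"
      using C(3) by (intro mult_left_mono) auto
    also have "\<dots> = ennreal (?k * (1 + N * \<epsilon>) * (H + \<epsilon>))"
      using k0 \<epsilon> H(2) by (intro ennreal_mult[symmetric]) (auto simp: N_def)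
    finally show ?thesis
      using k0 \<epsilon> H(2) by (subst (asm) ennreal_le_iff) (auto simp: N_def)
  qed
  have "((\<lambda>\<epsilon>. M * (1 + \<epsilon>)\<^sup>2 * (1 + N * \<epsilon>) * (H + \<epsilon>)) \<longlongrightarrow> M * H) (at_right 0)"
    by (auto intro!: tendsto_eq_intros)
  then show ?thesis
    unfolding H_def[symmetric]
    by (rule tendsto_lowerbound) (auto simp: eventually_at_filter est)
qed

section \<open>The area estimate\<close>

lemma D_x_eq:
  assumes "(f has_derivative L) (at w)" shows "D_x f w = L (1, 0)"
proof -
  obtain x y where w: "w = (x, y)" by (cases w)
  have "((\<lambda>t. (t, y)) has_derivative (\<lambda>h. (h, 0))) (at x)" by (auto intro!: derivative_eq_intros)
  from has_derivative_compose[OF this assms[unfolded w]]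
  have "((\<lambda>t. f (t, y)) has_derivative (\<lambda>h. L (h, 0))) (at x)" .
  moreover have "(\<lambda>h. L (h, 0)) = (*) (L (1, 0))"
  proof
    show "L (h, 0) = L (1, 0) * h" for h
      using linear_scale[OF has_derivative_linear[OF assms], of h "(1, 0)"] by (simp add: mult.commute)
  qed
  ultimately have "((\<lambda>t. f (t, y)) has_real_derivative L (1, 0)) (at x)"
    by (simp only: has_field_derivative_def)
  from DERIV_imp_deriv[OF this] show ?thesis by (simp add: w D_x_def)
qed

lemma D_y_eq:
  assumes "(f has_derivative L) (at w)" shows "D_y f w = L (0, 1)"
proof -
  obtain x y where w: "w = (x, y)" by (cases w)
  have "((\<lambda>t. (x, t)) has_derivative (\<lambda>h. (0, h))) (at y)" by (auto intro!: derivative_eq_intros)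
  from has_derivative_compose[OF this assms[unfolded w]]
  have "((\<lambda>t. f (x, t)) has_derivative (\<lambda>h. L (0, h))) (at y)" .
  moreover have "(\<lambda>h. L (0, h)) = (*) (L (0, 1))"
  proof
    show "L (0, h) = L (0, 1) * h" for h
      using linear_scale[OF has_derivative_linear[OF assms], of h "(0, 1)"] by (simp add: mult.commute)
  qed
  ultimately have "((\<lambda>t. f (x, t)) has_real_derivative L (0, 1)) (at y)"
    by (simp only: has_field_derivative_def)
  from DERIV_imp_deriv[OF this] show ?thesis by (simp add: w D_y_def)
qed

abbreviation e\<^sub>p :: real5 where "e\<^sub>p \<equiv> (0, 0, 0, 1, 0)"
abbreviation e\<^sub>q :: real5 where "e\<^sub>q \<equiv> (0, 0, 0, 0, 1)"

lemma D_p_eq: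
  assumes "(F has_derivative L) (at w)" shows "D_p F w = L e\<^sub>p"
proof -
  obtain x y z p q where w: "w = (x, y, z, p, q)" by (cases w)
  have "((\<lambda>t. (x, y, z, t, q)) has_derivative (\<lambda>h. (0, 0, 0, h, 0))) (at p)"
    by (auto intro!: derivative_eq_intros)
  from has_derivative_compose[OF this assms[unfolded w]]
  have "((\<lambda>t. F (x, y, z, t, q)) has_derivative (\<lambda>h. L (0, 0, 0, h, 0))) (at p)" .
  moreover have "(\<lambda>h. L (0, 0, 0, h, 0)) = (*) (L e\<^sub>p)"
  proof
    show "L (0, 0, 0, h, 0) = L e\<^sub>p * h" for h
      using linear_scale[OF has_derivative_linear[OF assms], of h e\<^sub>p] by (simp add: mult.commute)
  qed
  ultimately have "((\<lambda>t. F (x, y, z, t, q)) has_real_derivative L e\<^sub>p) (at p)"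
    by (simp only: has_field_derivative_def)
  from DERIV_imp_deriv[OF this] show ?thesis by (simp add: w D_p_def)
qed

lemma D_q_eq:
  assumes "(F has_derivative L) (at w)" shows "D_q F w = L e\<^sub>q"
proof -
  obtain x y z p q where w: "w = (x, y, z, p, q)" by (cases w)
  have "((\<lambda>t. (x, y, z, p, t)) has_derivative (\<lambda>h. (0, 0, 0, 0, h))) (at q)"
    by (auto intro!: derivative_eq_intros)
  from has_derivative_compose[OF this assms[unfolded w]]
  have "((\<lambda>t. F (x, y, z, p, t)) has_derivative (\<lambda>h. L (0, 0, 0, 0, h))) (at q)" .
  moreover have "(\<lambda>h. L (0, 0, 0, 0, h)) = (*) (L e\<^sub>q)"
  proof
    show "L (0, 0, 0, 0, h) = L e\<^sub>q * h" for h
      using linear_scale[OF has_derivative_linear[OF assms], of h e\<^sub>q] by (simp add: mult.commute)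
  qed
  ultimately have "((\<lambda>t. F (x, y, z, p, t)) has_real_derivative L e\<^sub>q) (at q)"
    by (simp only: has_field_derivative_def)
  from DERIV_imp_deriv[OF this] show ?thesis by (simp add: w D_q_def)
qed

lemma C2_on_D_p_D_q:
  assumes "C2_on F UNIV"
  obtains F2 :: "real5 \<Rightarrow> real5 \<Rightarrow>\<^sub>L real5 \<Rightarrow>\<^sub>L real"
  where "continuous_on UNIV F2"
    and "\<And>w. (D_p F has_derivative (\<lambda>h. F2 w h e\<^sub>p)) (at w)"
    and "\<And>w. (D_q F has_derivative (\<lambda>h. F2 w h e\<^sub>q)) (at w)"
proof -
  obtain F1 F2 where F1: "\<And>w. (F has_derivative blinfun_apply (F1 w)) (at w)"
    and F2: "\<And>w. (F1 has_derivative blinfun_apply (F2 w)) (at w)" and c: "continuous_on UNIV F2"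
    using assms unfolding C2_on_def C1_on_def by auto
  have p: "D_p F = (\<lambda>w. F1 w e\<^sub>p)" and q: "D_q F = (\<lambda>w. F1 w e\<^sub>q)"
    using D_p_eq[OF F1] D_q_eq[OF F1] by auto
  show thesis
  proof (rule that[OF c])
    show "(D_p F has_derivative (\<lambda>h. F2 w h e\<^sub>p)) (at w)" for w
      unfolding p by (rule bounded_linear.has_derivative[OF blinfun.bounded_linear_left F2])
    show "(D_q F has_derivative (\<lambda>h. F2 w h e\<^sub>q)) (at w)" for w
      unfolding q by (rule bounded_linear.has_derivative[OF blinfun.bounded_linear_left F2])
  qed
qed

text \<open>
Along the segment from the origin to \<open>(p, q)\<close> the function \<open>\<phi> t = p F\<^sub>p + q F\<^sub>q\<close>, taken at \<open>(t p, t q)\<close>,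
starts at zero and is nondecreasing by ellipticity, while its slope is at least \<open>m n\<^sup>2\<close> with
\<open>n\<^sup>2 = p\<^sup>2 + q\<^sup>2\<close> as long as \<open>t n \<le> 1\<close>. Stopping at \<open>t = min 1 (1/n)\<close> yields \<open>\<phi> 1 \<ge> m n\<^sup>2\<close> or
\<open>\<phi> 1 \<ge> m n\<close>, and \<open>sqrt (1 + n\<^sup>2) - 1\<close> is below both \<open>n\<^sup>2\<close> and \<open>n\<close>.
\<close>
lemma elliptic_lower_bound:
  fixes F :: "real5 \<Rightarrow> real"
  assumes C2: "C2_on F UNIV" and ell: "elliptic F" and m: "0 < m"
    and A2: "\<And>p q. \<And>\<xi> :: real^2. p\<^sup>2 + q\<^sup>2 \<le> 1 \<Longrightarrow>
               m * (norm \<xi>)\<^sup>2 \<le> \<xi> \<bullet> (pq_matrix F (x, y, z, p, q) *v \<xi>)"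
    and A3: "D_p F (x, y, z, 0, 0) = 0" "D_q F (x, y, z, 0, 0) = 0"
  shows "m * (sqrt (1 + p\<^sup>2 + q\<^sup>2) - 1) \<le> p * D_p F (x, y, z, p, q) + q * D_q F (x, y, z, p, q)"
proof -
  obtain F2 where dp: "\<And>w. (D_p F has_derivative (\<lambda>h. blinfun_apply (blinfun_apply (F2 w) h) e\<^sub>p)) (at w)"
    and dq: "\<And>w. (D_q F has_derivative (\<lambda>h. blinfun_apply (blinfun_apply (F2 w) h) e\<^sub>q)) (at w)"
    by (rule C2_on_D_p_D_q[OF C2], rule that)
  define \<xi> :: "real^2" where "\<xi> = vector [p, q]"
  define n where "n = sqrt (p\<^sup>2 + q\<^sup>2)"
  have n2: "n\<^sup>2 = p\<^sup>2 + q\<^sup>2" and n0: "0 \<le> n" by (simp_all add: n_def)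
  have norm\<xi>: "(norm \<xi>)\<^sup>2 = n\<^sup>2"
    unfolding power2_norm_eq_inner n2 by (simp add: inner_vec_def sum_2 \<xi>_def power2_eq_square)
  define J where "J t = (x, y, z, t * p, t * q)" for t
  define \<phi> where "\<phi> t = p * D_p F (J t) + q * D_q F (J t)" for t
  define \<phi>' where "\<phi>' t = \<xi> \<bullet> (pq_matrix F (J t) *v \<xi>)" for t
  have d\<phi>: "(\<phi> has_real_derivative \<phi>' t) (at t)" for t
  proof -
    have dJ: "(J has_derivative (\<lambda>h. h *\<^sub>R (p *\<^sub>R e\<^sub>p + q *\<^sub>R e\<^sub>q))) (at t)"
      unfolding J_def by (auto intro!: derivative_eq_intros simp: fun_eq_iff)
    have "(\<phi> has_derivative (\<lambda>h. p * F2 (J t) (h *\<^sub>R (p *\<^sub>R e\<^sub>p + q *\<^sub>R e\<^sub>q)) e\<^sub>p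
        + q * F2 (J t) (h *\<^sub>R (p *\<^sub>R e\<^sub>p + q *\<^sub>R e\<^sub>q)) e\<^sub>q)) (at t)"
      unfolding \<phi>_def
      by (intro has_derivative_add has_derivative_mult_right has_derivative_compose[OF dJ dp]
          has_derivative_compose[OF dJ dq])
    moreover have "p * F2 (J t) (h *\<^sub>R (p *\<^sub>R e\<^sub>p + q *\<^sub>R e\<^sub>q)) e\<^sub>p
        + q * F2 (J t) (h *\<^sub>R (p *\<^sub>R e\<^sub>p + q *\<^sub>R e\<^sub>q)) e\<^sub>q = \<phi>' t * h" for h
      unfolding blinfun.scaleR_right blinfun.add_right blinfun.scaleR_left blinfun.add_left
      by (simp add: \<phi>'_def \<xi>_def pq_matrix_def inner_vec_def sum_2 matrix_vector_mult_def
          D_p_eq[OF dp] D_q_eq[OF dp] D_p_eq[OF dq] D_q_eq[OF dq] algebra_simps)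
    ultimately show ?thesis by (simp add: has_field_derivative_def)
  qed
  have \<phi>'0: "0 \<le> \<phi>' t" for t
  proof (cases "\<xi> = 0")
    case False
    then have "0 < \<phi>' t" using ell unfolding elliptic_def pos_definite_def \<phi>'_def by blast
    then show ?thesis by simp
  qed (simp add: \<phi>'_def)
  have \<phi>'m: "m * n\<^sup>2 \<le> \<phi>' t" if "0 \<le> t" "t * n \<le> 1" for t
  proof -
    have "(t * n)\<^sup>2 \<le> 1" using that n0 by (simp add: power_le_one)
    then have "(t * p)\<^sup>2 + (t * q)\<^sup>2 \<le> 1" by (simp add: power_mult_distrib n2 algebra_simps)
    from A2[OF this, of \<xi>] show ?thesis by (simp add: \<phi>'_def J_def norm\<xi>)
  qed
  have \<phi>0: "\<phi> 0 = 0" using A3 by (simp add: \<phi>_def J_def)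
  have \<phi>1: "\<phi> 1 = p * D_p F (x, y, z, p, q) + q * D_q F (x, y, z, p, q)" by (simp add: \<phi>_def J_def)
  have key: "m * n\<^sup>2 * T \<le> \<phi> 1" if T: "0 < T" "T \<le> 1" "T * n \<le> 1" for T
  proof -
    obtain t where t: "0 < t" "t < T" "\<phi> T - \<phi> 0 = (T - 0) * \<phi>' t"
      using MVT2[OF T(1), of \<phi> \<phi>', OF d\<phi>] by blast
    have "t * n \<le> T * n" using t n0 by (intro mult_right_mono) auto
    then have "m * n\<^sup>2 \<le> \<phi>' t" using t T by (intro \<phi>'m) auto
    then have "T * (m * n\<^sup>2) \<le> T * \<phi>' t" using T by (intro mult_left_mono) auto
    also have "\<dots> = \<phi> T" using t(3) \<phi>0 by simp
    also have "\<dots> \<le> \<phi> 1"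
      by (rule DERIV_nonneg_imp_nondecreasing[OF T(2)]) (intro exI conjI, rule d\<phi>, rule \<phi>'0)
    finally show ?thesis by (simp add: mult_ac)
  qed
  have goal: "m * (sqrt (1 + n\<^sup>2) - 1) \<le> \<phi> 1"
  proof (cases "n \<le> 1")
    case True
    have "1 + n\<^sup>2 \<le> (1 + n\<^sup>2)\<^sup>2" by (rule self_le_power) auto
    then have "sqrt (1 + n\<^sup>2) \<le> 1 + n\<^sup>2" by (intro real_le_lsqrt) auto
    then have "m * (sqrt (1 + n\<^sup>2) - 1) \<le> m * n\<^sup>2" using m by (intro mult_left_mono) auto
    then show ?thesis using key[of 1] True by simp
  next
    case False
    have "sqrt (1 + n\<^sup>2) \<le> 1 + n"
      using n0 by (intro real_le_lsqrt) (auto simp: power2_eq_square algebra_simps)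
    then have "m * (sqrt (1 + n\<^sup>2) - 1) \<le> m * n" using m by (intro mult_left_mono) auto
    then show ?thesis using key[of "1 / n"] False by (simp add: power2_eq_square)
  qed
  then show ?thesis by (simp add: n2 \<phi>1 add.assoc)
qed

lemma sup_norm_on_upper:
  assumes "compact K" "S \<subseteq> K" "continuous_on K h" "\<And>w. w \<in> S \<Longrightarrow> f w = h w" "w \<in> S"
  shows "\<bar>f w\<bar> \<le> sup_norm_on S f"
proof -
  have "bounded (h ` K)" using assms by (intro compact_imp_bounded compact_continuous_image)
  then obtain c where c: "\<And>w. w \<in> K \<Longrightarrow> \<bar>h w\<bar> \<le> c" unfolding bounded_iff by auto
  have "\<bar>f w\<bar> \<le> c" if "w \<in> S" for w using c[of w] assms(2,4) that by auto
  then have "bdd_above ((\<lambda>w. \<bar>f w\<bar>) ` S)" by (rule bdd_aboveI2)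
  then show ?thesis unfolding sup_norm_on_def using assms(5) by (rule cSUP_upper[rotated])
qed

theorem mainTheorem4:
  fixes \<Omega> :: "(real \<times> real) set"
    and F R :: "real \<times> real \<times> real \<times> real \<times> real \<Rightarrow> real"
    and \<zeta> \<phi> :: "real \<times> real \<Rightarrow> real"
    and k\<^sub>0 m\<^sub>1 :: real
  assumes domain: "open \<Omega>" "connected \<Omega>" "\<Omega> \<noteq> {}"
    and "bounded \<Omega>" and "simply_connected \<Omega>" and "C1_regular_boundary \<Omega>"
    and "C2_on F UNIV" and "continuous_on UNIV R"
    and "C2_on \<zeta> \<Omega>" and "C1_on_closure \<zeta> \<Omega>" and "C1_on \<phi> UNIV"
    and ell: "elliptic F"
    and pde: "\<forall>w\<in>\<Omega>. D_x (\<lambda>v. D_p F (jet \<zeta> v)) w + D_y (\<lambda>v. D_q F (jet \<zeta> v)) w = R (jet \<zeta> w)"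
    and bc: "\<forall>w\<in>frontier \<Omega>. \<zeta> w = \<phi> w"
    and "0 \<le> k\<^sub>0"
    and A1: "\<forall>w. (D_p F w)\<^sup>2 + (D_q F w)\<^sup>2 \<le> k\<^sub>0\<^sup>2"
    and "0 < m\<^sub>1"
    and A2: "\<forall>x y z p q. \<forall>\<xi> :: real^2. p\<^sup>2 + q\<^sup>2 \<le> 1 \<longrightarrow>
               m\<^sub>1 * (norm \<xi>)\<^sup>2 \<le> \<xi> \<bullet> (pq_matrix F (x, y, z, p, q) *v \<xi>)"
    and A3: "\<forall>x y z. D_p F (x, y, z, 0, 0) = 0 \<and> D_q F (x, y, z, 0, 0) = 0"
  shows "graph_area \<Omega> \<zeta> \<le>
           (1 + sup_norm_on \<Omega> \<zeta> * sup_norm_on \<Omega> (\<lambda>w. R (jet \<zeta> w)) / m\<^sub>1) * measure lborel \<Omega>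
           + sup_norm_on (frontier \<Omega>) \<zeta> * k\<^sub>0 / m\<^sub>1 * curve_length (frontier \<Omega>)"
proof -
  note op = \<open>open \<Omega>\<close> and bd = \<open>bounded \<Omega>\<close>
  have cpt: "compact (closure \<Omega>)" using bd by (simp add: compact_closure)
  have cptF: "compact (frontier \<Omega>)" using bd by (rule compact_frontier_bounded)
  have Fcl: "frontier \<Omega> \<subseteq> closure \<Omega>" by (simp add: frontier_def)
  have sub: "\<Omega> \<subseteq> closure \<Omega>" by (rule closure_subset)
  obtain f where c\<zeta>: "continuous_on (closure \<Omega>) \<zeta>" and cf: "continuous_on (closure \<Omega>) f"
    and d\<zeta>: "\<And>w. w \<in> \<Omega> \<Longrightarrow> (\<zeta> has_derivative blinfun_apply (f w)) (at w)"
    using \<open>C1_on_closure \<zeta> \<Omega>\<close> unfolding C1_on_closure_def by blast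
  obtain f2 f2' where f2: "\<And>w. w \<in> \<Omega> \<Longrightarrow> (\<zeta> has_derivative blinfun_apply (f2 w)) (at w)"
    and df2: "\<And>w. w \<in> \<Omega> \<Longrightarrow> (f2 has_derivative blinfun_apply (f2' w)) (at w)"
    and cf2': "continuous_on \<Omega> f2'"
    using \<open>C2_on \<zeta> \<Omega>\<close> unfolding C2_on_def C1_on_def by blast
  have "f2 w = f w" if "w \<in> \<Omega>" for w
    using has_derivative_unique[OF f2[OF that] d\<zeta>[OF that]] by (simp add: blinfun_apply_inject)
  then have df: "(f has_derivative blinfun_apply (f2' w)) (at w)" if "w \<in> \<Omega>" for w
    using has_derivative_transform_within_open[OF df2[OF that] op that] by blast
  obtain F2 :: "real5 \<Rightarrow> real5 \<Rightarrow>\<^sub>L real5 \<Rightarrow>\<^sub>L real" where cF2: "continuous_on UNIV F2"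
    and dp: "\<And>w. (D_p F has_derivative (\<lambda>h. F2 w h e\<^sub>p)) (at w)"
    and dq: "\<And>w. (D_q F has_derivative (\<lambda>h. F2 w h e\<^sub>q)) (at w)"
    by (rule C2_on_D_p_D_q[OF \<open>C2_on F UNIV\<close>], rule that)
  \<comment> \<open>The jet, continued to the boundary by the continuous extension \<open>f\<close> of the derivative; there \<open>D_x\<close> and \<open>D_y\<close> carry no information.\<close>
  define P where "P w = (fst w, snd w, \<zeta> w, f w (1, 0), f w (0, 1))" for w
  define P' where "P' w h = (fst h, snd h, f w h, f2' w h (1, 0), f2' w h (0, 1))" for w h
  have jetP: "jet \<zeta> w = P w" and Dx\<zeta>: "D_x \<zeta> w = f w (1, 0)" and Dy\<zeta>: "D_y \<zeta> w = f w (0, 1)"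
    if "w \<in> \<Omega>" for w
    using D_x_eq[OF d\<zeta>[OF that]] D_y_eq[OF d\<zeta>[OF that]]
    by (simp_all add: jet_def P_def split_beta)
  have cP: "continuous_on (closure \<Omega>) P"
    unfolding P_def by (intro continuous_intros c\<zeta> blinfun.continuous_on cf)
  have dP: "(P has_derivative P' w) (at w)" if w: "w \<in> \<Omega>" for w
    unfolding P_def P'_def
    by (intro has_derivative_Pair has_derivative_fst has_derivative_snd has_derivative_ident d\<zeta>[OF w]
        bounded_linear.has_derivative[OF blinfun.bounded_linear_left df[OF w]])
  have cP': "continuous_on \<Omega> (\<lambda>w. P' w h)" for h
    unfolding P'_def
    by (intro continuous_intros blinfun.continuous_on cf2' continuous_on_subset[OF cf sub])
  define V where "V w = (D_p F (P w), D_q F (P w))" for w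
  define V' where "V' w h = (F2 (P w) (P' w h) e\<^sub>p, F2 (P w) (P' w h) e\<^sub>q)" for w h
  define W where "W w = \<zeta> w *\<^sub>R V w" for w
  define W' where "W' w h = \<zeta> w *\<^sub>R V' w h + f w h *\<^sub>R V w" for w h
  have cDp: "continuous_on UNIV (D_p F)" and cDq: "continuous_on UNIV (D_q F)"
    by (rule continuous_at_imp_continuous_on, rule ballI, rule has_derivative_continuous, rule dp dq)+
  have cDpP: "continuous_on (closure \<Omega>) (\<lambda>w. D_p F (P w))" and cDqP: "continuous_on (closure \<Omega>) (\<lambda>w. D_q F (P w))"
    and cRP: "continuous_on (closure \<Omega>) (\<lambda>w. R (P w))"
    by (rule continuous_on_compose2[OF _ cP subset_UNIV]; fact)+
  have cV: "continuous_on (closure \<Omega>) V"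
    unfolding V_def by (intro continuous_intros cDpP cDqP)
  have dDp: "((\<lambda>w. D_p F (P w)) has_derivative (\<lambda>h. F2 (P w) (P' w h) e\<^sub>p)) (at w)"
    and dDq: "((\<lambda>w. D_q F (P w)) has_derivative (\<lambda>h. F2 (P w) (P' w h) e\<^sub>q)) (at w)" if "w \<in> \<Omega>" for w
    using has_derivative_compose[OF dP[OF that] dp] has_derivative_compose[OF dP[OF that] dq] .
  have dV: "(V has_derivative V' w) (at w)" if "w \<in> \<Omega>" for w
    unfolding V_def V'_def using dDp[OF that] dDq[OF that] by (rule has_derivative_Pair)
  have cF2P: "continuous_on \<Omega> (\<lambda>w. F2 (P w))"
    by (rule continuous_on_compose2[OF cF2 continuous_on_subset[OF cP sub]]) auto
  have cV': "continuous_on \<Omega> (\<lambda>w. V' w h)" for h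
    unfolding V'_def by (intro continuous_intros blinfun.continuous_on cF2P cP')
  have cW: "continuous_on (closure \<Omega>) W"
    unfolding W_def by (intro continuous_intros c\<zeta> cV)
  have dW: "(W has_derivative W' w) (at w)" if "w \<in> \<Omega>" for w
    unfolding W_def W'_def by (rule has_derivative_scaleR[OF d\<zeta>[OF that] dV[OF that]])
  have cW': "continuous_on \<Omega> (\<lambda>w. W' w h)" for h
    unfolding W'_def
    by (intro continuous_intros blinfun.continuous_on cV' continuous_on_subset[OF cf sub]
        continuous_on_subset[OF c\<zeta> sub] continuous_on_subset[OF cV sub])
  \<comment> \<open>The gradient of \<open>\<zeta>\<close> paired with the field \<open>V\<close>: the part of the divergence of \<open>W = \<zeta> V\<close> that dominates the area.\<close>
  define E where "E w = f w (1, 0) * D_p F (P w) + f w (0, 1) * D_q F (P w)" for w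
  have tr: "trace2 (W' w) = \<zeta> w * R (P w) + E w" if w: "w \<in> \<Omega>" for w
  proof -
    have jp: "((\<lambda>v. D_p F (jet \<zeta> v)) has_derivative (\<lambda>h. F2 (P w) (P' w h) e\<^sub>p)) (at w)"
      by (rule has_derivative_transform_within_open[OF dDp[OF w] op w]) (simp add: jetP)
    have jq: "((\<lambda>v. D_q F (jet \<zeta> v)) has_derivative (\<lambda>h. F2 (P w) (P' w h) e\<^sub>q)) (at w)"
      by (rule has_derivative_transform_within_open[OF dDq[OF w] op w]) (simp add: jetP)
    have "F2 (P w) (P' w (1, 0)) e\<^sub>p + F2 (P w) (P' w (0, 1)) e\<^sub>q = R (P w)"
      using bspec[OF pde w] unfolding D_x_eq[OF jp] D_y_eq[OF jq] jetP[OF w] .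
    moreover have "trace2 (W' w)
        = \<zeta> w * (F2 (P w) (P' w (1, 0)) e\<^sub>p + F2 (P w) (P' w (0, 1)) e\<^sub>q) + E w"
      by (simp add: trace2_def W'_def V'_def V_def E_def algebra_simps)
    ultimately show ?thesis by simp
  qed
  have "continuous_on (closure \<Omega>) (\<lambda>w. \<zeta> w * R (P w) + E w)"
    unfolding E_def by (intro continuous_intros blinfun.continuous_on cf c\<zeta> cRP cDpP cDqP)
  then have "bounded ((\<lambda>w. \<zeta> w * R (P w) + E w) ` closure \<Omega>)"
    using cpt compact_continuous_image compact_imp_bounded by blast
  then obtain K where K0: "\<And>w. w \<in> closure \<Omega> \<Longrightarrow> \<bar>\<zeta> w * R (P w) + E w\<bar> \<le> K"
    unfolding bounded_iff by auto
  have K: "\<bar>trace2 (W' w)\<bar> \<le> K" if "w \<in> \<Omega>" for w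
    unfolding tr[OF that] by (rule K0[OF subsetD[OF sub that]])
  define Z where "Z = sup_norm_on \<Omega> \<zeta>"
  define Rs where "Rs = sup_norm_on \<Omega> (\<lambda>w. R (jet \<zeta> w))"
  define Zb where "Zb = sup_norm_on (frontier \<Omega>) \<zeta>"
  have Z: "\<bar>\<zeta> w\<bar> \<le> Z" if "w \<in> \<Omega>" for w
    unfolding Z_def by (rule sup_norm_on_upper[OF cpt sub c\<zeta> refl that])
  have Rs: "\<bar>R (P w)\<bar> \<le> Rs" if "w \<in> \<Omega>" for w
    using sup_norm_on_upper[OF cpt sub cRP _ that, of "\<lambda>w. R (jet \<zeta> w)"] that by (simp add: Rs_def jetP)
  have Zb: "\<bar>\<zeta> w\<bar> \<le> Zb" if "w \<in> frontier \<Omega>" for w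
    unfolding Zb_def by (rule sup_norm_on_upper[OF cpt Fcl c\<zeta> refl that])
  have M: "norm (W w) \<le> Zb * k\<^sub>0" if "w \<in> frontier \<Omega>" for w
  proof -
    have "norm (V w) \<le> k\<^sub>0"
      using spec[OF A1, of "P w"] \<open>0 \<le> k\<^sub>0\<close> by (simp add: V_def norm_Pair real_le_lsqrt)
    then show ?thesis
      unfolding W_def norm_scaleR real_norm_def
      using Zb[OF that] \<open>0 \<le> k\<^sub>0\<close> order_trans[OF abs_ge_zero Zb[OF that]] by (intro mult_mono) auto
  qed
  have bnd: "\<bar>LINT w:\<Omega>|lborel. trace2 (W' w)\<bar> \<le> Zb * k\<^sub>0 * curve_length (frontier \<Omega>)"
    by (rule divergence_le_boundary[OF op bd \<open>\<Omega> \<noteq> {}\<close> \<open>C1_regular_boundary \<Omega>\<close> cW dW cW' K M])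
  define G where "G w = sqrt (1 + (f w (1, 0))\<^sup>2 + (f w (0, 1))\<^sup>2)" for w
  have cG: "continuous_on (closure \<Omega>) G"
    unfolding G_def by (intro continuous_intros blinfun.continuous_on cf)
  then have "bounded (G ` closure \<Omega>)"
    using cpt compact_continuous_image compact_imp_bounded by blast
  then obtain KG where KG: "\<And>w. w \<in> closure \<Omega> \<Longrightarrow> \<bar>G w\<bar> \<le> KG"
    unfolding bounded_iff by auto
  have iG: "set_integrable lborel \<Omega> G"
    by (rule set_integrable_continuous_bounded[OF op bd continuous_on_subset[OF cG sub] KG[OF subsetD[OF sub]]])
  have iW: "set_integrable lborel \<Omega> (\<lambda>w. trace2 (W' w))"
    by (rule set_integrable_continuous_bounded[OF op bd _ K])
      (unfold trace2_def, intro continuous_intros cW')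
  have ic: "set_integrable lborel \<Omega> (\<lambda>w. c)" for c :: real
    by (rule set_integrable_continuous_bounded[OF op bd continuous_on_const order_refl])
  have intc: "(LINT w:\<Omega>|lborel. c) = c * measure lborel \<Omega>" for c :: real
    by (simp add: set_lebesgue_integral_def)
  have area: "graph_area \<Omega> \<zeta> = (LINT w:\<Omega>|lborel. G w)"
    unfolding graph_area_def
  proof (rule set_lebesgue_integral_cong, use op in simp, intro allI impI)
    show "sqrt (1 + (D_x \<zeta> w)\<^sup>2 + (D_y \<zeta> w)\<^sup>2) = G w" if "w \<in> \<Omega>" for w
      unfolding G_def Dx\<zeta>[OF that] Dy\<zeta>[OF that] ..
  qed
  have pt: "m\<^sub>1 * G w - m\<^sub>1 \<le> trace2 (W' w) + Z * Rs" if w: "w \<in> \<Omega>" for w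
  proof -
    have "m\<^sub>1 * (G w - 1) \<le> E w"
      unfolding E_def G_def P_def
      by (rule elliptic_lower_bound[OF \<open>C2_on F UNIV\<close> ell \<open>0 < m\<^sub>1\<close>])
        (erule A2[rule_format], rule A3[rule_format, THEN conjunct1], rule A3[rule_format, THEN conjunct2])
    moreover have "\<bar>\<zeta> w * R (P w)\<bar> \<le> Z * Rs"
      unfolding abs_mult using Z[OF w] Rs[OF w] by (intro mult_mono) auto
    ultimately show ?thesis unfolding tr[OF w] right_diff_distrib by linarith
  qed
  note imG = set_integrable_mult_right[OF iG, of m\<^sub>1]
  have "(LINT w:\<Omega>|lborel. m\<^sub>1 * G w - m\<^sub>1) \<le> (LINT w:\<Omega>|lborel. trace2 (W' w) + Z * Rs)"
    by (rule set_integral_mono[OF set_integral_diff(1)[OF imG ic] set_integral_add(1)[OF iW ic] pt])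
  then have "m\<^sub>1 * graph_area \<Omega> \<zeta> - m\<^sub>1 * measure lborel \<Omega>
      \<le> (LINT w:\<Omega>|lborel. trace2 (W' w)) + Z * Rs * measure lborel \<Omega>"
    unfolding set_integral_diff(2)[OF imG ic] set_integral_add(2)[OF iW ic] intc area
    by (simp only: set_integral_mult_right)
  then have "m\<^sub>1 * graph_area \<Omega> \<zeta>
      \<le> m\<^sub>1 * measure lborel \<Omega> + Z * Rs * measure lborel \<Omega> + Zb * k\<^sub>0 * curve_length (frontier \<Omega>)"
    using bnd by linarith
  then have "graph_area \<Omega> \<zeta>
      \<le> (m\<^sub>1 * measure lborel \<Omega> + Z * Rs * measure lborel \<Omega> + Zb * k\<^sub>0 * curve_length (frontier \<Omega>)) / m\<^sub>1"
    unfolding pos_le_divide_eq[OF \<open>0 < m\<^sub>1\<close>] by (simp only: mult.commute)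
  also have "\<dots> = (1 + Z * Rs / m\<^sub>1) * measure lborel \<Omega> + Zb * k\<^sub>0 / m\<^sub>1 * curve_length (frontier \<Omega>)"
    using \<open>0 < m\<^sub>1\<close> by (simp add: add_divide_distrib distrib_right)
  finally show ?thesis unfolding Z_def Rs_def Zb_def .
qed

end
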